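(* Let $\mu$ be a Borel measure on $\mathbb{R}^d$ with $\mu(Q)<\infty$ for every $Q\in\mathscr{D}$, let $1\le k\le 2^d$, and let $f\in L^1(\mu)$ with $\operatorname{supp}f\subset\mathbb{R}^d_k$. Then for every $\lambda>\langle|f|\rangle_{\mathbb{R}^d_k}$ there is a covering of $\Omega_\lambda=\{M_{\mathscr{D}}f>\lambda\}$ by disjoint maximal dyadic cubes $\{Q_j\}_j\subset\mathscr{D}^k$ (maximal in the sense that $\langle|f|\rangle_Q\le\lambda<\langle|f|\rangle_{Q_j}$ for all dyadic $Q\supsetneq Q_j$), and writing $f=g+b+\beta$ with $$g=f\,1_{\mathbb{R}^d\setminus\Omega_\lambda}+\sum_j\langle f\rangle_{\widehat{Q}_j}1_{Q_j}+\sum_j\big(\langle f\rangle_{Q_j}-\langle f\rangle_{\widehat{Q}_j}\big)\frac{\mu(Q_j)}{\mu(\widehat{Q}_j)}1_{\widehat{Q}_j},$$ $b=\sum_jb_j$, $b_j=(f-\langle f\rangle_{Q_j})1_{Q_j}$, $\beta=\sum_j\beta_j$, $\beta_j=(\langle f\rangle_{Q_j}-\langle f\rangle_{\widehat{Q}_j})\big(1_{Q_j}-\frac{\mu(Q_j)}{\mu(\widehat{Q}_j)}1_{\widehat{Q}_j}\big)$, one has: (a) $\|g\|_{L^p(\mu)}^p\le C_p\lambda^{p-1}\|f\|_{L^1(\mu)}$ for every $1\le p<\infty$, with $C_p$ depending only on $p$; (b) $\operatorname{supp}b_j\subset Q_j$, $\int b_j\,d\mu=0$, $\sum_j\|b_j\|_{L^1(\mu)}\le2\|f\|_{L^1(\mu)}$;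 (c) $\operatorname{supp}\beta_j\subset\widehat{Q}_j$, $\int\beta_j\,d\mu=0$, $\sum_j\|\beta_j\|_{L^1(\mu)}\le4\|f\|_{L^1(\mu)}$.
   Context: $\mathscr{D}$ is the standard dyadic grid of $\mathbb{R}^d$, $\widehat{Q}$ the dyadic parent of $Q$. $\mathbb{R}^d_k$, $1\le k\le2^d$, are the $d$-dimensional quadrants $\mathbb{R}^{\pm}\times\dots\times\mathbb{R}^{\pm}$ with $\mathbb{R}^+=[0,\infty)$, $\mathbb{R}^-=(-\infty,0)$, and $\mathscr{D}^k$ is the set of dyadic cubes contained in $\mathbb{R}^d_k$. $\langle f\rangle_Q=\mu(Q)^{-1}\int_Qf\,d\mu$ ($=0$ if $\mu(Q)=0$); $\langle f\rangle_{\mathbb{R}^d_k}=\mu(\mathbb{R}^d_k)^{-1}\int_{\mathbb{R}^d_k}f\,d\mu$ if $\mu(\mathbb{R}^d_k)<\infty$ and $=0$ if $\mu(\mathbb{R}^d_k)=\infty$. $M_{\mathscr{D}}f(x)=\sup_{x\in Q\in\mathscr{D}}\langle|f|\rangle_Q$. *)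

theory Defs
  imports "HOL-Analysis.Analysis"
begin

definition Rd :: "nat \<Rightarrow> (nat \<Rightarrow> real) set" where
  "Rd d = PiE {..<d} (\<lambda>_. UNIV)"

definition dyadic_cube :: "nat \<Rightarrow> int \<Rightarrow> (nat \<Rightarrow> int) \<Rightarrow> (nat \<Rightarrow> real) set" where
  "dyadic_cube d k m = {x \<in> Rd d. \<forall>i<d.
      real_of_int (m i) * 2 powr (- real_of_int k) \<le> x i \<and>
      x i < real_of_int (m i + 1) * 2 powr (- real_of_int k)}"

definition dyadic :: "nat \<Rightarrow> (nat \<Rightarrow> real) set \<Rightarrow> bool" where
  "dyadic d Q \<longleftrightarrow> (\<exists>k m. Q = dyadic_cube d k m)"

definition dparent :: "nat \<Rightarrow> (nat \<Rightarrow> real) set \<Rightarrow> (nat \<Rightarrow> real) set" where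
  "dparent d Q = (THE P. \<exists>k m. Q = dyadic_cube d k m \<and> P = dyadic_cube d (k - 1) (\<lambda>i. m i div 2))"

definition quadrant :: "nat \<Rightarrow> (nat \<Rightarrow> bool) \<Rightarrow> (nat \<Rightarrow> real) set" where
  "quadrant d s = {x \<in> Rd d. \<forall>i<d. if s i then 0 \<le> x i else x i < 0}"

definition avg :: "'a measure \<Rightarrow> 'a set \<Rightarrow> ('a \<Rightarrow> real) \<Rightarrow> real" where
  "avg M A f = (if emeasure M A = 0 \<or> emeasure M A = \<infinity> then 0
                else (LINT x:A|M. f x) / measure M A)"

definition dmax :: "nat \<Rightarrow> (nat \<Rightarrow> real) measure \<Rightarrow> ((nat \<Rightarrow> real) \<Rightarrow> real) \<Rightarrow> (nat \<Rightarrow> real) \<Rightarrow> ereal" where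
  "dmax d M f x = (SUP Q\<in>{Q. dyadic d Q \<and> x \<in> Q}. ereal (avg M Q (\<lambda>y. \<bar>f y\<bar>)))"

definition cz_b :: "nat \<Rightarrow> (nat \<Rightarrow> real) measure \<Rightarrow> ((nat \<Rightarrow> real) \<Rightarrow> real) \<Rightarrow> (nat \<Rightarrow> real) set
    \<Rightarrow> (nat \<Rightarrow> real) \<Rightarrow> real" where
  "cz_b d M f Q x = (f x - avg M Q f) * indicator Q x"

definition cz_beta :: "nat \<Rightarrow> (nat \<Rightarrow> real) measure \<Rightarrow> ((nat \<Rightarrow> real) \<Rightarrow> real) \<Rightarrow> (nat \<Rightarrow> real) set
    \<Rightarrow> (nat \<Rightarrow> real) \<Rightarrow> real" where
  "cz_beta d M f Q x = (avg M Q f - avg M (dparent d Q) f) *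
      (indicator Q x - measure M Q / measure M (dparent d Q) * indicator (dparent d Q) x)"

definition cz_g :: "nat \<Rightarrow> (nat \<Rightarrow> real) measure \<Rightarrow> ((nat \<Rightarrow> real) \<Rightarrow> real) \<Rightarrow> (nat \<Rightarrow> real) set
    \<Rightarrow> (nat \<Rightarrow> real) set set \<Rightarrow> (nat \<Rightarrow> real) \<Rightarrow> real" where
  "cz_g d M f \<Omega> \<Q> x = f x * indicator (space M - \<Omega>) x
      + (\<Sum>\<^sub>\<infinity>Q\<in>\<Q>. avg M (dparent d Q) f * indicator Q x)
      + (\<Sum>\<^sub>\<infinity>Q\<in>\<Q>. (avg M Q f - avg M (dparent d Q) f) * (measure M Q / measure M (dparent d Q))
                       * indicator (dparent d Q) x)"

end

theory Submission
  imports Defs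
begin

text \<open>
  The cubes are the maximal dyadic cubes on which the average of \<open>\<bar>f\<bar>\<close> exceeds \<open>\<lambda>\<close>; they exist because
  the dyadic ancestors of a cube exhaust its quadrant, where the average is below \<open>\<lambda>\<close>. The delicate
  point is the \<open>L\<^sup>p\<close> bound for the last sum of \<open>g\<close>, since the parents of the selected cubes overlap.
  That sum is dominated by twice \<open>S\<close>, the sum over the selected cubes \<open>Q\<close> with parent \<open>P\<close> of
  \<open>(\<integral>\<^sub>Q \<bar>f\<bar> / \<mu> P) 1\<^sub>P\<close>. As \<open>\<integral>\<^sub>P \<bar>f\<bar> \<le> \<lambda> \<mu> P\<close> for every such \<open>P\<close>, the coefficients of \<open>S\<close> satisfy a Carleson
  packing condition with constant \<open>\<lambda>\<close>, and hence \<open>\<integral> S\<^sup>n \<le> n! \<lambda>\<^sup>n\<^sup>-\<^sup>1 \<integral> \<bar>f\<bar>\<close> for integers \<open>n \<ge> 1\<close>. Other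
  exponents follow from \<open>t\<^sup>p \<le> t + t\<^sup>n\<close> for \<open>1 \<le> p \<le> n\<close>.
\<close>

section \<open>Dyadic cubes\<close>

text \<open>No doubling of \<mu> is assumed, so the average over a selected cube Q may be far above
  \<lambda>; only the average over its parent P is at most \<lambda> in absolute value. Hence
  \<open>g\<close> carries the parent average on Q, and the excess \<open>jump Q\<close> is spread
  over P with the factor \<mu> Q / \<mu> P, which preserves its integral. The stopping inequality
  \<lambda> \<mu> Q < \<integral>_Q |f| yields |jump Q| \<mu> Q \<le> 2 \<integral>_Q |f|, the
  source of the factor 2 before S. The factorial comes from iterating (a + b)^(n+1) \<le> b^(n+1) +
  (n+1) a (a + b)^n along the nested parents through a point: each round costs an integer factor,
  and packing turns it into one factor \<lambda>. The rest of \<open>g\<close> is at most \<lambda>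
  almost everywhere. Off the level set this means |f| \<le> \<lambda>, usually a matter of
  differentiation along shrinking cubes; here the measures |f| \<mu> and \<lambda> \<mu> are
  compared on unions of cubes of one scale, an algebra that generates the Borel sets. The moment
  bounds concern finite subfamilies; Fatou's lemma and almost everywhere summability carry them over
  to the full sum.\<close>

lemma mem_dyadic_cube_iff:
  "x \<in> dyadic_cube d k m \<longleftrightarrow> x \<in> Rd d \<and> (\<forall>i<d. \<lfloor>x i * 2 powr real_of_int k\<rfloor> = m i)"
proof -
  have "real_of_int a * 2 powr (- real_of_int k) \<le> t \<and> t < real_of_int (a + 1) * 2 powr (- real_of_int k)
     \<longleftrightarrow> \<lfloor>t * 2 powr real_of_int k\<rfloor> = a" for a :: int and t :: real
    unfolding floor_eq_iff powr_minus by (simp add: field_simps)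
  then show ?thesis
    unfolding dyadic_cube_def by auto
qed

text \<open>Indexing by a scale and a point makes the cubes through \<open>x\<close> a single chain
  in \<open>k\<close>, and turns questions about the grid into questions about floors. Larger
  \<open>k\<close> means smaller cubes.\<close>

definition dcube :: "nat \<Rightarrow> int \<Rightarrow> (nat \<Rightarrow> real) \<Rightarrow> (nat \<Rightarrow> real) set" where
  "dcube d k x = dyadic_cube d k (\<lambda>i. \<lfloor>x i * 2 powr real_of_int k\<rfloor>)"

lemma mem_dcube_iff:
  "y \<in> dcube d k x \<longleftrightarrow>
     y \<in> Rd d \<and> (\<forall>i<d. \<lfloor>y i * 2 powr real_of_int k\<rfloor> = \<lfloor>x i * 2 powr real_of_int k\<rfloor>)"
  unfolding dcube_def mem_dyadic_cube_iff by simp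

lemma dcube_self: "x \<in> Rd d \<Longrightarrow> x \<in> dcube d k x"
  by (simp add: mem_dcube_iff)

lemma dyadic_dcube: "dyadic d (dcube d k x)"
  by (auto simp: dyadic_def dcube_def)

lemma dyadic_cube_eq_dcube: "x \<in> dyadic_cube d k m \<Longrightarrow> dyadic_cube d k m = dcube d k x"
  by (auto simp: mem_dyadic_cube_iff mem_dcube_iff)

lemma dyadic_eq_dcube: "dyadic d Q \<Longrightarrow> x \<in> Q \<Longrightarrow> \<exists>k. Q = dcube d k x"
  unfolding dyadic_def using dyadic_cube_eq_dcube by blast

lemma dcube_cong: "y \<in> dcube d k x \<Longrightarrow> dcube d k y = dcube d k x"
  by (auto simp: mem_dcube_iff)

lemma dyadic_subset_Rd: "dyadic d Q \<Longrightarrow> Q \<subseteq> Rd d"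
  by (auto simp: dyadic_def dyadic_cube_def)

lemma dyadic_nonempty: assumes "dyadic d Q" shows "Q \<noteq> {}"
proof -
  obtain k m where Q: "Q = dyadic_cube d k m"
    using assms by (auto simp: dyadic_def)
  have "(\<lambda>i\<in>{..<d}. real_of_int (m i) * 2 powr (- real_of_int k)) \<in> Q"
    unfolding Q mem_dyadic_cube_iff by (auto simp: Rd_def mult.assoc simp flip: powr_add)
  then show ?thesis by auto
qed

text \<open>Going up \<open>n\<close> generations is integer division of the corner by
  \<open>2 ^ n\<close>. Since \<open>div\<close> rounds down, this is right for negative coordinates
  too; nesting of cubes and the formula in \<open>dparent\<close> both rest on it.\<close>

lemma floor_powr_div:
  "\<lfloor>t * 2 powr real_of_int (k - int n)\<rfloor> = \<lfloor>t * 2 powr real_of_int k\<rfloor> div 2 ^ n"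
proof -
  have "t * 2 powr real_of_int (k - int n) = t * 2 powr real_of_int k / real_of_int (2 ^ n)"
    by (simp add: powr_diff powr_realpow)
  moreover have "(0::int) \<le> 2 ^ n" by simp
  ultimately show ?thesis
    by (simp only: floor_divide_real_eq_div)
qed

lemma dcube_antimono: assumes "k' \<le> k" shows "dcube d k x \<subseteq> dcube d k' x"
proof -
  have "\<lfloor>t * 2 powr real_of_int k'\<rfloor> = \<lfloor>t * 2 powr real_of_int k\<rfloor> div 2 ^ nat (k - k')" for t
    using floor_powr_div[of t k "nat (k - k')"] assms by simp
  then show ?thesis
    by (auto simp: mem_dcube_iff)
qed

lemma dyadic_nested:
  assumes "dyadic d P" "dyadic d Q" "P \<inter> Q \<noteq> {}"
  shows "P \<subseteq> Q \<or> Q \<subseteq> P"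
proof -
  obtain x where "x \<in> P" "x \<in> Q" using assms by auto
  then obtain k l where "P = dcube d k x" "Q = dcube d l x"
    using assms dyadic_eq_dcube by meson
  then show ?thesis
    using dcube_antimono linear[of k l] by blast
qed

text \<open>With \<open>d \<ge> 1\<close> one coordinate suffices to see the side length; for
  \<open>d = 0\<close> all cubes coincide and carry no scale.\<close>

lemma dcube_coordinate_0:
  assumes "1 \<le> d" "x \<in> Rd d"
  shows "(\<lambda>y. y 0) ` dcube d k x =
     {real_of_int \<lfloor>x 0 * 2 powr k\<rfloor> * 2 powr (-k) ..< real_of_int (\<lfloor>x 0 * 2 powr k\<rfloor> + 1) * 2 powr (-k)}"
    (is "_ = {?a..<?b}")
proof -
  have *: "?a \<le> t \<and> t < ?b \<longleftrightarrow> \<lfloor>t * 2 powr real_of_int k\<rfloor> = \<lfloor>x 0 * 2 powr k\<rfloor>" for t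
    unfolding floor_eq_iff powr_minus by (simp add: field_simps)
  have "t \<in> (\<lambda>y. y 0) ` dcube d k x" if "\<lfloor>t * 2 powr real_of_int k\<rfloor> = \<lfloor>x 0 * 2 powr k\<rfloor>" for t
    using that assms by (intro image_eqI[of _ _ "x(0 := t)"]) (auto simp: mem_dcube_iff Rd_def PiE_def extensional_def)
  then show ?thesis
    using * assms by (auto simp: mem_dcube_iff)
qed

text \<open>A nonempty half-open interval determines its end points, and their distance is the side
  length \<open>2 powr (-k)\<close>. This makes the parent of a cube well defined.\<close>

lemma dcube_inj_scale:
  assumes "1 \<le> d" "x \<in> Rd d" "dcube d k x = dcube d l x"
  shows "k = l"
proof -
  have less: "real_of_int \<lfloor>x 0 * 2 powr k\<rfloor> * 2 powr (-k) < real_of_int (\<lfloor>x 0 * 2 powr k\<rfloor> + 1) * 2 powr (-k)" for k :: int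
    by simp
  have eq: "real_of_int \<lfloor>x 0 * 2 powr k\<rfloor> * 2 powr (-k) = real_of_int \<lfloor>x 0 * 2 powr l\<rfloor> * 2 powr (-l) \<and>
     real_of_int (\<lfloor>x 0 * 2 powr k\<rfloor> + 1) * 2 powr (-k) = real_of_int (\<lfloor>x 0 * 2 powr l\<rfloor> + 1) * 2 powr (-l)"
    using dcube_coordinate_0[OF assms(1,2), of k] dcube_coordinate_0[OF assms(1,2), of l] assms(3)
    by (intro iffD1[OF atLeastLessThan_eq_iff[OF less[of k] less[of l]]]) simp
  then have "2 powr (- real_of_int k) = 2 powr (- real_of_int l)"
    by (simp add: algebra_simps)
  then show ?thesis
    using powr_inj[of 2 "- real_of_int k" "- real_of_int l"] by simp
qed

text \<open>The description in \<open>dparent\<close> must not depend on the chosen \<open>k\<close>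
  and \<open>m\<close>: the scale is determined by the cube, and so are the values of
  \<open>m\<close> at indices below \<open>d\<close>, namely as floors of the coordinates of
  \<open>x\<close>.\<close>

lemma dparent_dcube:
  assumes "1 \<le> d" "x \<in> Rd d"
  shows "dparent d (dcube d k x) = dcube d (k - 1) x"
  unfolding dparent_def
proof (rule the_equality)
  have fl: "\<lfloor>t * 2 powr real_of_int k\<rfloor> div 2 = \<lfloor>t * 2 powr real_of_int (k - 1)\<rfloor>" for t k
    using floor_powr_div[of t k 1] by simp
  show "\<exists>l m. dcube d k x = dyadic_cube d l m \<and> dcube d (k - 1) x = dyadic_cube d (l - 1) (\<lambda>i. m i div 2)"
    by (intro exI[of _ k] exI[of _ "\<lambda>i. \<lfloor>x i * 2 powr real_of_int k\<rfloor>"]) (simp add: fl dcube_def)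
  fix P assume "\<exists>l m. dcube d k x = dyadic_cube d l m \<and> P = dyadic_cube d (l - 1) (\<lambda>i. m i div 2)"
  then obtain l m where lm: "dcube d k x = dyadic_cube d l m" "P = dyadic_cube d (l - 1) (\<lambda>i. m i div 2)"
    by blast
  have x: "x \<in> dyadic_cube d l m"
    using lm(1) dcube_self[OF assms(2)] by auto
  then have "l = k"
    using dcube_inj_scale[OF assms, of l k] lm(1) dyadic_cube_eq_dcube[OF x] by simp
  then have "x \<in> P"
    using x unfolding lm mem_dyadic_cube_iff fl[symmetric] by simp
  then show "P = dcube d (k - 1) x"
    using dyadic_cube_eq_dcube lm \<open>l = k\<close> by blast
qed

lemma
  assumes "1 \<le> d" "dyadic d Q"
  shows dyadic_dparent: "dyadic d (dparent d Q)" and psubset_dparent: "Q \<subset> dparent d Q"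
proof -
  obtain x where x: "x \<in> Q" using dyadic_nonempty assms by blast
  then have xR: "x \<in> Rd d" using assms dyadic_subset_Rd by blast
  obtain k where Q: "Q = dcube d k x" using dyadic_eq_dcube x assms by blast
  show "dyadic d (dparent d Q)"
    by (simp add: Q dparent_dcube[OF assms(1) xR] dyadic_dcube)
  show "Q \<subset> dparent d Q"
    unfolding Q dparent_dcube[OF assms(1) xR] psubset_eq
    using dcube_antimono[of "k - 1" k] dcube_inj_scale[OF assms(1) xR, of k "k - 1"] by auto
qed

lemma countable_dyadic: "countable {Q. dyadic d Q}"
proof -
  have "{Q. dyadic d Q} \<subseteq> (\<lambda>(k, m). dyadic_cube d k m) ` (UNIV \<times> PiE {..<d} (\<lambda>_. UNIV))"
  proof clarify
    fix Q assume "dyadic d Q"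
    then obtain k m where Q: "Q = dyadic_cube d k m" by (auto simp: dyadic_def)
    \<comment> \<open>The values of \<open>m\<close> from index \<open>d\<close> on do not affect
      the cube; unrestricted, the parameters would form an uncountable function space.\<close>
    also have "\<dots> = dyadic_cube d k (restrict m {..<d})"
      by (auto simp: mem_dyadic_cube_iff)
    finally show "Q \<in> (\<lambda>(k, m). dyadic_cube d k m) ` (UNIV \<times> PiE {..<d} (\<lambda>_. UNIV))"
      by (intro image_eqI[of _ _ "(k, restrict m {..<d})"]) auto
  qed
  moreover have "countable ((UNIV :: int set) \<times> PiE {..<d} (\<lambda>_. UNIV :: int set))"
    by (intro countable_SIGMA countable_PiE) auto
  ultimately show ?thesis
    by (meson countable_image countable_subset)
qed

text \<open>Quadrants put 0 on the nonnegative side, just as half-open cubes do, so the floor has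
  the same sign pattern as the point at every scale. Hence no dyadic cube straddles two
  quadrants.\<close>

lemma quadrant_iff_floor:
  "x \<in> quadrant d s \<longleftrightarrow> x \<in> Rd d \<and> (\<forall>i<d. s i \<longleftrightarrow> 0 \<le> \<lfloor>x i * 2 powr real_of_int k\<rfloor>)"
  by (auto simp: quadrant_def zero_le_mult_iff not_less split: if_splits)

lemma dyadic_subset_quadrant:
  assumes "dyadic d Q" "x \<in> Q" "x \<in> quadrant d s"
  shows "Q \<subseteq> quadrant d s"
proof -
  obtain k where "Q = dcube d k x" using dyadic_eq_dcube assms by blast
  then show ?thesis
    using assms(3) by (auto simp: mem_dcube_iff quadrant_iff_floor[where k = k])
qed

text \<open>Once \<open>2 ^ n\<close> exceeds all scaled coordinates of two points, their floors at
  scale \<open>k - n\<close> are 0 or -1 according to sign, hence equal if both points lie in the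
  same quadrant.\<close>

lemma quadrant_subset_UN_dcube:
  assumes "x \<in> quadrant d s"
  shows "quadrant d s \<subseteq> (\<Union>n. dcube d (k - int n) x)"
proof
  fix y assume y: "y \<in> quadrant d s"
  have "\<exists>n::nat. \<forall>i<d. \<bar>x i\<bar> * 2 powr k < 2 ^ n \<and> \<bar>y i\<bar> * 2 powr k < 2 ^ n"
  proof -
    define B where "B = (\<Sum>i<d. \<bar>x i\<bar> * 2 powr k + \<bar>y i\<bar> * 2 powr k)"
    obtain n where n: "B < 2 ^ n"
      using real_arch_pow[of 2 B] by auto
    have "\<bar>x i\<bar> * 2 powr k + \<bar>y i\<bar> * 2 powr k \<le> B" if "i < d" for i
      unfolding B_def using that by (intro member_le_sum) auto
    then show ?thesis using n
      by (intro exI[of _ n]) (smt (verit) mult_nonneg_nonneg powr_ge_zero)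
  qed
  then obtain n :: nat where n: "\<And>i. i < d \<Longrightarrow> \<bar>x i\<bar> * 2 powr k < 2 ^ n \<and> \<bar>y i\<bar> * 2 powr k < 2 ^ n"
    by blast
  have fl: "\<lfloor>t * 2 powr real_of_int (k - int n)\<rfloor> = (if 0 \<le> t then 0 else - 1)"
    if "\<bar>t\<bar> * 2 powr k < 2 ^ n" for t
  proof -
    have eq: "t * 2 powr real_of_int (k - int n) = t * 2 powr k / 2 ^ n"
      by (simp add: powr_diff powr_realpow)
    have "\<bar>t * 2 powr k\<bar> < 2 ^ n" using that by (simp add: abs_mult)
    moreover have "0 \<le> t * 2 powr k \<longleftrightarrow> 0 \<le> t" by (simp add: zero_le_mult_iff)
    ultimately show ?thesis
      unfolding eq floor_eq_iff by (auto simp: field_simps abs_if split: if_splits)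
  qed
  have "y \<in> dcube d (k - int n) x"
    using assms y n fl unfolding mem_dcube_iff quadrant_def
    by (smt (verit, ccfv_threshold) mem_Collect_eq)
  then show "y \<in> (\<Union>n. dcube d (k - int n) x)" by blast
qed

section \<open>Unions of cubes of one scale\<close>

definition scale_algebra :: "nat \<Rightarrow> (nat \<Rightarrow> real) set set" where
  "scale_algebra d = {E. E \<subseteq> Rd d \<and> (\<exists>n. \<forall>x\<in>E. dcube d (int n) x \<subseteq> E)}"

lemma scale_algebraE:
  assumes "E \<in> scale_algebra d"
  obtains n where "E \<subseteq> Rd d" "\<And>x k. x \<in> E \<Longrightarrow> int n \<le> k \<Longrightarrow> dcube d k x \<subseteq> E"
proof -
  obtain n where n: "E \<subseteq> Rd d" "\<forall>x\<in>E. dcube d (int n) x \<subseteq> E"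
    using assms by (auto simp: scale_algebra_def)
  show thesis
    by (rule that[of n]) (use n dcube_antimono in \<open>blast+\<close>)
qed

lemma algebra_scale_algebra: "algebra (Rd d) (scale_algebra d)"
  unfolding algebra_iff_Un
proof (intro conjI ballI)
  show "scale_algebra d \<subseteq> Pow (Rd d)" by (auto simp: scale_algebra_def)
  show "{} \<in> scale_algebra d" by (auto simp: scale_algebra_def)
next
  fix E assume "E \<in> scale_algebra d"
  then obtain n where n: "E \<subseteq> Rd d" "\<forall>x\<in>E. dcube d (int n) x \<subseteq> E"
    by (auto simp: scale_algebra_def)
  have "dcube d (int n) x \<subseteq> Rd d - E" if "x \<in> Rd d - E" for x
  proof
    fix y assume y: "y \<in> dcube d (int n) x"
    then have "x \<in> dcube d (int n) y"
      using that by (auto simp: mem_dcube_iff)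
    then have "y \<notin> E"
      using n(2) that by blast
    then show "y \<in> Rd d - E"
      using y by (simp add: mem_dcube_iff)
  qed
  then show "Rd d - E \<in> scale_algebra d"
    by (auto simp: scale_algebra_def)
next
  fix E F assume "E \<in> scale_algebra d" "F \<in> scale_algebra d"
  then obtain m n where
    "E \<subseteq> Rd d" "\<And>x k. x \<in> E \<Longrightarrow> int m \<le> k \<Longrightarrow> dcube d k x \<subseteq> E"
    "F \<subseteq> Rd d" "\<And>x k. x \<in> F \<Longrightarrow> int n \<le> k \<Longrightarrow> dcube d k x \<subseteq> F"
    using scale_algebraE by metis
  then show "E \<union> F \<in> scale_algebra d"
    unfolding scale_algebra_def
    by (intro CollectI conjI exI[of _ "max m n"]) (auto, (meson max.cobounded1 max.cobounded2 of_nat_mono subsetD)+)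
qed

lemma scale_algebra_Union:
  assumes "E \<in> scale_algebra d"
  obtains n where "E = \<Union>(dcube d (int n) ` E)"
proof -
  obtain n where n: "E \<subseteq> Rd d" "\<forall>x\<in>E. dcube d (int n) x \<subseteq> E"
    using assms by (auto simp: scale_algebra_def)
  then show thesis
    using that[of n] dcube_self[of _ d "int n"] by blast
qed

lemma countable_dcube_image: "countable (dcube d k ` E)"
  by (rule countable_subset[OF _ countable_dyadic[of d]]) (auto simp: dyadic_dcube)

text \<open>Exhibits a coordinate as a limit of functions that are constant on the cubes of a scale,
  which will show that these cubes generate the Borel sets.\<close>

lemma floor_scale_tendsto: "(\<lambda>n. real_of_int \<lfloor>t * 2 powr real n\<rfloor> / 2 powr real n) \<longlonglongrightarrow> t"
proof (rule tendsto_sandwich)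
  have "t - 1 / 2 powr real n \<le> real_of_int \<lfloor>t * 2 powr real n\<rfloor> / 2 powr real n" for n
  proof -
    have "t * 2 powr real n - 1 \<le> real_of_int \<lfloor>t * 2 powr real n\<rfloor>" by linarith
    then have "(t * 2 powr real n - 1) / 2 powr real n \<le> real_of_int \<lfloor>t * 2 powr real n\<rfloor> / 2 powr real n"
      by (rule divide_right_mono) simp
    then show ?thesis by (simp add: diff_divide_distrib)
  qed
  then show "\<forall>\<^sub>F n in sequentially. t - 1 / 2 powr real n \<le> real_of_int \<lfloor>t * 2 powr real n\<rfloor> / 2 powr real n"
    by simp
  show "\<forall>\<^sub>F n in sequentially. real_of_int \<lfloor>t * 2 powr real n\<rfloor> / 2 powr real n \<le> t"
    by (simp add: pos_divide_le_eq)
  have "(\<lambda>n. t - (1 / 2) ^ n) \<longlonglongrightarrow> t - 0"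
    by (intro tendsto_intros) auto
  then show "(\<lambda>n. t - 1 / 2 powr real n) \<longlonglongrightarrow> t"
    by (simp add: powr_realpow power_divide)
qed simp

lemma space_Rd: "sets M = sets (PiM {..<d} (\<lambda>_. borel :: real measure)) \<Longrightarrow> space M = Rd d"
  by (drule sets_eq_imp_space_eq) (simp add: space_PiM Rd_def)

lemma measurable_coordinate:
  assumes "sets M = sets (PiM {..<d} (\<lambda>_. borel :: real measure))" "i < d"
  shows "(\<lambda>x. x i) \<in> borel_measurable M"
  using assms(2) measurable_component_singleton[of i "{..<d}" "\<lambda>_. borel :: real measure"]
  by (subst measurable_cong_sets[OF assms(1) refl]) simp

lemma dyadic_measurable:
  assumes "sets M = sets (PiM {..<d} (\<lambda>_. borel :: real measure))" "dyadic d Q"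
  shows "Q \<in> sets M"
proof -
  obtain k m where Q: "Q = dyadic_cube d k m" using assms by (auto simp: dyadic_def)
  note measurable_coordinate[OF assms(1), measurable]
  have "Q = {x \<in> space M. \<forall>i\<in>{..<d}. \<lfloor>x i * 2 powr real_of_int k\<rfloor> = m i}"
    by (auto simp: Q mem_dyadic_cube_iff space_Rd[OF assms(1)])
  also have "\<dots> \<in> sets M"
    by (intro sets.sets_Collect_finite_All) auto
  finally show ?thesis .
qed

section \<open>Measures and countable sums\<close>

text \<open>Carries a comparison of |f| \<mu> with \<lambda> \<mu>, in either direction, from single
  pieces to countable disjoint unions.\<close>

lemma emeasure_UN_disjoint_mono:
  assumes "sets M = sets N" "countable \<C>" "disjoint \<C>" "\<C> \<subseteq> sets M"
    and le: "\<And>C. C \<in> \<C> \<Longrightarrow> emeasure M C \<le> emeasure N C"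
  shows "emeasure M (\<Union>\<C>) \<le> emeasure N (\<Union>\<C>)"
proof -
  have "disjoint_family_on (\<lambda>C. C) \<C>"
    using assms(3) by (simp add: disjoint_family_on_def disjoint_def)
  then have "emeasure M (\<Union>\<C>) = (\<integral>\<^sup>+C. emeasure M C \<partial>count_space \<C>)"
    and "emeasure N (\<Union>\<C>) = (\<integral>\<^sup>+C. emeasure N C \<partial>count_space \<C>)"
    using emeasure_UN_countable[of \<C> "\<lambda>C. C" M] emeasure_UN_countable[of \<C> "\<lambda>C. C" N] assms
    by auto
  then show ?thesis
    using le by (auto intro!: nn_integral_mono)
qed

lemma sum_emeasure_disjoint_le:
  assumes "finite F" "disjoint F" "F \<subseteq> sets M" "\<And>A. A \<in> F \<Longrightarrow> A \<subseteq> B" "B \<in> sets M"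
  shows "(\<Sum>A\<in>F. emeasure M A) \<le> emeasure M B"
proof -
  have "(\<Sum>A\<in>F. emeasure M A) = emeasure M (\<Union>A\<in>F. A)"
    using assms by (intro sum_emeasure) (auto simp: disjoint_family_on_def disjoint_def)
  also have "\<dots> \<le> emeasure M B"
    using assms by (intro emeasure_mono) auto
  finally show ?thesis .
qed

text \<open>The approximable sets form a \<sigma>-algebra. Countable unions are the only real case:
  finiteness of the measure allows truncation to finitely many sets at cost \<open>e / 2\<close>,
  and these are approximated one by one.\<close>

lemma (in finite_measure) approximation_in_algebra:
  assumes alg: "algebra (space M) \<A>" and sets: "sets M = sigma_sets (space M) \<A>"
    and "A \<in> sets M" "e > 0"
  shows "\<exists>E\<in>\<A>. measure M (sym_diff A E) < e"
proof -
  interpret alg: algebra "space M" \<A> by fact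
  from assms(3)[unfolded sets] assms(4) show ?thesis
  proof (induction arbitrary: e rule: sigma_sets.induct)
    case (Basic a)
    then show ?case by (intro bexI[of _ a]) simp_all
  next
    case Empty
    then show ?case
      by (intro bexI[of _ "{}"]) auto
  next
    case (Compl a)
    then obtain E where E: "E \<in> \<A>" "measure M (sym_diff a E) < e" by blast
    have "sym_diff (space M - a) (space M - E) \<subseteq> sym_diff a E"
      by auto
    moreover have "sym_diff a E \<in> sets M"
      using Compl.hyps E(1) sets by (intro sets.Un sets.Diff) auto
    ultimately have "measure M (sym_diff (space M - a) (space M - E)) < e"
      using E(2) by (blast intro: le_less_trans finite_measure_mono)
    then show ?case
      using alg.compl_sets[OF E(1)] by blast
  next
    case (Union a)
    have a[measurable]: "a i \<in> sets M" for i
      using Union.hyps sets by auto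
    have \<A>: "\<A> \<subseteq> sets M" using sets by auto
    have "(\<lambda>n. measure M (\<Union>i<n. a i)) \<longlonglongrightarrow> measure M (\<Union>n. \<Union>i<n. a i)"
      by (intro finite_Lim_measure_incseq) (auto simp: incseq_def, force)
    also have "(\<Union>n. \<Union>i<n. a i) = (\<Union>i. a i)" by auto
    finally have "\<forall>\<^sub>F n in sequentially. measure M (\<Union>i<n. a i) > measure M (\<Union>i. a i) - e / 2"
      using Union.prems by (intro order_tendstoD) auto
    then obtain n where n: "measure M (\<Union>i<n. a i) > measure M (\<Union>i. a i) - e / 2"
      by (meson eventually_sequentially order_refl)
    \<comment> \<open>Dividing by \<open>n + 1\<close> shares the other \<open>e / 2\<close> among
      the \<open>n\<close> sets kept, and stays meaningful for \<open>n = 0\<close>.\<close>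
    have "\<forall>i. \<exists>E. E \<in> \<A> \<and> measure M (sym_diff (a i) E) < e / (2 * (real n + 1))"
      using Union.IH[of "e / (2 * (real n + 1))"] Union.prems by (fold Bex_def) simp
    then obtain E where E: "\<And>i. E i \<in> \<A>" "\<And>i. measure M (sym_diff (a i) (E i)) < e / (2 * (real n + 1))"
      using choice[of "\<lambda>i E. E \<in> \<A> \<and> measure M (sym_diff (a i) E) < e / (2 * (real n + 1))"] by blast
    have E'[measurable]: "E i \<in> sets M" for i using E(1) \<A> by auto
    have "measure M (sym_diff (\<Union>i. a i) (\<Union>i<n. E i)) \<le>
          measure M (((\<Union>i. a i) - (\<Union>i<n. a i)) \<union> (\<Union>i<n. sym_diff (a i) (E i)))"
      by (rule finite_measure_mono) auto
    also have "\<dots> \<le> measure M ((\<Union>i. a i) - (\<Union>i<n. a i)) + measure M (\<Union>i<n. sym_diff (a i) (E i))"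
      by (rule measure_subadditive) auto
    also have "measure M ((\<Union>i. a i) - (\<Union>i<n. a i)) = measure M (\<Union>i. a i) - measure M (\<Union>i<n. a i)"
      by (rule finite_measure_Diff) auto
    also have "measure M (\<Union>i<n. sym_diff (a i) (E i)) \<le> (\<Sum>i<n. measure M (sym_diff (a i) (E i)))"
      by (rule finite_measure_subadditive_finite) auto
    also have "\<dots> \<le> (\<Sum>i<n. e / (2 * (real n + 1)))"
      using E(2) by (intro sum_mono) (simp add: less_imp_le)
    also have "\<dots> \<le> e / 2"
      using Union.prems by (simp add: field_simps)
    finally have "measure M (sym_diff (\<Union>i. a i) (\<Union>i<n. E i)) < e"
      using n by linarith
    moreover have "(\<Union>i<n. E i) \<in> \<A>"
      using E(1) by auto
    ultimately show ?case by blast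
  qed
qed

text \<open>Replaces the Lebesgue differentiation theorem below.\<close>
lemma AE_nonpos_from_algebra:
  fixes w :: "'a \<Rightarrow> real"
  assumes alg: "algebra (space M) \<A>" and M: "sets M = sigma_sets (space M) \<A>"
    and w: "integrable M w"
    and le: "\<And>E. E \<in> \<A> \<Longrightarrow> (\<integral>x. w x * indicator E x \<partial>M) \<le> 0"
  shows "AE x in M. w x \<le> 0"
proof -
  note w[measurable]
  \<comment> \<open>Weighted by |w|, the symmetric difference of \<open>A\<close> and
    \<open>E\<close> bounds the change of the integral of \<open>w\<close> when the set
    \<open>A\<close> where \<open>w\<close> is positive is replaced by a set \<open>E\<close> of the
    algebra.\<close>
  define \<rho> where "\<rho> = density M (\<lambda>x. ennreal \<bar>w x\<bar>)"
  have \<rho>: "emeasure \<rho> B = ennreal (\<integral>x. \<bar>w x\<bar> * indicator B x \<partial>M)" if [measurable]: "B \<in> sets M" for B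
  proof -
    have "emeasure \<rho> B = (\<integral>\<^sup>+x. ennreal (\<bar>w x\<bar> * indicator B x) \<partial>M)"
      unfolding \<rho>_def by (subst emeasure_density) (auto intro!: nn_integral_cong split: split_indicator)
    also have "\<dots> = ennreal (\<integral>x. \<bar>w x\<bar> * indicator B x \<partial>M)"
      using w by (intro nn_integral_eq_integral) (auto intro: integrable_real_mult_indicator)
    finally show ?thesis .
  qed
  have [simp]: "sets \<rho> = sets M" "space \<rho> = space M" by (simp_all add: \<rho>_def)
  interpret \<rho>: finite_measure \<rho>
    by standard (simp add: \<rho>)
  define A where "A = {x \<in> space M. w x > 0}"
  have A[measurable]: "A \<in> sets M" unfolding A_def by measurable
  have "(\<integral>x. w x * indicator A x \<partial>M) \<le> e" if "e > 0" for e
  proof -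
    obtain E where E: "E \<in> \<A>" "measure \<rho> (sym_diff A E) < e"
      using \<rho>.approximation_in_algebra[of \<A> A e] alg M A \<open>e > 0\<close>
      by (auto simp del: sets.sigma_sets_eq)
    have E'[measurable]: "E \<in> sets M" using E M by auto
    have i: "integrable M (\<lambda>x. w x * indicator B x)" "integrable M (\<lambda>x. \<bar>w x\<bar> * indicator B x)"
      if "B \<in> sets M" for B
      using w that by (auto intro: integrable_real_mult_indicator)
    have "(\<integral>x. w x * indicator A x \<partial>M)
        \<le> (\<integral>x. w x * indicator E x + \<bar>w x\<bar> * indicator (sym_diff A E) x \<partial>M)"
      by (intro integral_mono Bochner_Integration.integrable_add i)
         (auto split: split_indicator)
    also have "\<dots> = (\<integral>x. w x * indicator E x \<partial>M) + (\<integral>x. \<bar>w x\<bar> * indicator (sym_diff A E) x \<partial>M)"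
      by (intro Bochner_Integration.integral_add i) auto
    also have "(\<integral>x. \<bar>w x\<bar> * indicator (sym_diff A E) x \<partial>M) = measure \<rho> (sym_diff A E)"
      unfolding measure_def by (subst \<rho>) auto
    finally show ?thesis
      using le[OF E(1)] E(2) by linarith
  qed
  then have "(\<integral>x. w x * indicator A x \<partial>M) \<le> 0"
    by (rule field_le_epsilon[where y = 0, simplified])
  have nonneg: "0 \<le> w x * indicator A x" for x
    by (auto simp: A_def split: split_indicator)
  then have "0 \<le> (\<integral>x. w x * indicator A x \<partial>M)"
    by (intro integral_nonneg_AE AE_I2)
  with \<open>(\<integral>x. w x * indicator A x \<partial>M) \<le> 0\<close> have "(\<integral>x. w x * indicator A x \<partial>M) = 0"
    by (simp add: antisym)
  then have "AE x in M. w x * indicator A x = 0"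
    using integral_nonneg_eq_0_iff_AE[OF integrable_real_mult_indicator[OF A w]] nonneg by simp
  then show ?thesis
    using AE_space by eventually_elim (auto simp: A_def indicator_def split: if_splits)
qed

section \<open>Powers of sums and the Carleson embedding\<close>

text \<open>The mean value estimate for the power \<open>Suc n\<close>, written without subtraction
  so that it makes sense in an ordered semiring.\<close>

lemma add_power_le:
  fixes a b :: "'a :: linordered_semidom"
  assumes "0 \<le> a" "0 \<le> b"
  shows "(a + b) ^ Suc n \<le> b ^ Suc n + of_nat (Suc n) * a * (a + b) ^ n"
proof (induction n)
  case (Suc n)
  have "b * (a + b) ^ Suc n \<le> b * (b ^ Suc n + of_nat (Suc n) * a * (a + b) ^ n)"
    by (intro mult_left_mono Suc assms)
  also have "\<dots> \<le> b * b ^ Suc n + of_nat (Suc n) * a * (a + b) ^ Suc n"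
  proof -
    have "of_nat (Suc n) * a * (b * (a + b) ^ n) \<le> of_nat (Suc n) * a * ((a + b) * (a + b) ^ n)"
      using assms by (intro mult_left_mono mult_right_mono) auto
    then show ?thesis by (simp add: algebra_simps)
  qed
  finally have "b * (a + b) ^ Suc n \<le> b * b ^ Suc n + of_nat (Suc n) * a * (a + b) ^ Suc n" .
  then have "a * (a + b) ^ Suc n + b * (a + b) ^ Suc n \<le>
      a * (a + b) ^ Suc n + (b * b ^ Suc n + of_nat (Suc n) * a * (a + b) ^ Suc n)"
    by (rule add_left_mono)
  then show ?case by (simp add: algebra_simps)
qed (simp add: add.commute)

text \<open>A discrete form of integrating the derivative of a power along the chain. Peel off an
  index \<open>j\<close> whose set is largest: its inner sum is the whole sum, so
  \<open>add_power_le\<close> produces exactly its term, and induction handles the rest.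
  \<open>P\<close> need not be injective, since siblings share a parent.\<close>

lemma sum_power_le_chain:
  fixes c :: "'i \<Rightarrow> 'a :: linordered_semidom"
  assumes "finite F" "\<And>i. i \<in> F \<Longrightarrow> 0 \<le> c i"
    and "\<And>i j. i \<in> F \<Longrightarrow> j \<in> F \<Longrightarrow> P i \<subseteq> P j \<or> P j \<subseteq> P i"
  shows "(\<Sum>i\<in>F. c i) ^ Suc n \<le> of_nat (Suc n) * (\<Sum>j\<in>F. c j * (\<Sum>i | i \<in> F \<and> P i \<subseteq> P j. c i) ^ n)"
  using assms
proof (induction "card F" arbitrary: F)
  case 0
  then show ?case by simp
next
  case (Suc k)
  then have fin: "finite (P ` F)" and "P ` F \<noteq> {}" by auto
  then obtain B where B: "B \<in> P ` F" "\<And>C. C \<in> P ` F \<Longrightarrow> B \<le> C \<Longrightarrow> B = C"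
    using finite_has_maximal by metis
  then obtain j where j: "j \<in> F" "B = P j" by auto
  have top: "P i \<subseteq> P j" if "i \<in> F" for i
    using Suc.prems(3)[OF that j(1)] B(2) j(2) that by blast
  define G where "G = F - {j}"
  have F: "F = insert j G" and jG: "j \<notin> G" and G: "finite G" "card G = k"
    using Suc j by (auto simp: G_def)
  have cnn: "0 \<le> c i" if "i \<in> F" for i using Suc.prems that by auto
  have "(\<Sum>i\<in>F. c i) ^ Suc n = (c j + (\<Sum>i\<in>G. c i)) ^ Suc n"
    by (simp only: F sum.insert[OF G(1) jG])
  also have "\<dots> \<le> (\<Sum>i\<in>G. c i) ^ Suc n + of_nat (Suc n) * c j * (c j + (\<Sum>i\<in>G. c i)) ^ n"
    using cnn F by (intro add_power_le sum_nonneg) auto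
  also have "c j + (\<Sum>i\<in>G. c i) = (\<Sum>i | i \<in> F \<and> P i \<subseteq> P j. c i)"
  proof -
    have "{i. i \<in> F \<and> P i \<subseteq> P j} = F" using top by auto
    then show ?thesis by (simp only: F sum.insert[OF G(1) jG])
  qed
  also have "(\<Sum>i\<in>G. c i) ^ Suc n \<le>
      of_nat (Suc n) * (\<Sum>l\<in>G. c l * (\<Sum>i | i \<in> G \<and> P i \<subseteq> P l. c i) ^ n)"
    using G Suc.prems F by (intro Suc.hyps(1)) auto
  \<comment> \<open>Indices \<open>l\<close> with the same set as \<open>j\<close> lost
    \<open>j\<close> from their inner sums; putting it back only enlarges them.\<close>
  also have "\<dots> \<le> of_nat (Suc n) * (\<Sum>l\<in>G. c l * (\<Sum>i | i \<in> F \<and> P i \<subseteq> P l. c i) ^ n)"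
    using cnn F G(1)
    by (intro mult_left_mono sum_mono power_mono sum_mono2 sum_nonneg) auto
  finally show ?case
    by (simp only: F sum.insert[OF G(1) jG]) (simp add: algebra_simps)
qed

text \<open>A finite sum is bounded by the sum of its coefficients, so all factors but one can be
  replaced by a constant.\<close>

lemma integrable_indicator_sum_power:
  fixes c :: "'i \<Rightarrow> real"
  assumes "finite F" "\<And>i. i \<in> F \<Longrightarrow> 0 \<le> c i" "\<And>i. i \<in> F \<Longrightarrow> P i \<in> sets M"
    "\<And>i. i \<in> F \<Longrightarrow> emeasure M (P i) < \<infinity>"
  shows "integrable M (\<lambda>x. (\<Sum>i\<in>F. c i * indicator (P i) x) ^ Suc n)"
proof -
  let ?h = "\<lambda>x. \<Sum>i\<in>F. c i * indicator (P i) x"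
  have h: "integrable M ?h"
    using assms by (intro Bochner_Integration.integrable_sum integrable_mult_right integrable_real_indicator) auto
  have h0: "0 \<le> ?h x" for x
    using assms by (intro sum_nonneg) auto
  have hK: "?h x \<le> (\<Sum>i\<in>F. c i)" for x
    using assms by (intro sum_mono) (auto split: split_indicator)
  show ?thesis
  proof (rule Bochner_Integration.integrable_bound)
    show "integrable M (\<lambda>x. (\<Sum>i\<in>F. c i) ^ n * ?h x)"
      using h by (rule integrable_mult_right)
    show "(\<lambda>x. ?h x ^ Suc n) \<in> borel_measurable M"
      using h by measurable
    have "?h x ^ Suc n \<le> (\<Sum>i\<in>F. c i) ^ n * ?h x" for x
      using power_mono[OF hK h0, of x n] h0[of x] by (simp add: mult.commute[of _ "?h x"] mult_left_mono)
    moreover have "0 \<le> ?h x ^ Suc n" for x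
      by (rule zero_le_power[OF h0])
    ultimately show "AE x in M. norm (?h x ^ Suc n) \<le> norm ((\<Sum>i\<in>F. c i) ^ n * ?h x)"
      by (smt (verit, best) AE_I2 real_norm_def)
  qed
qed

text \<open>The chain inequality at each point bounds the next power by terms \<open>c j\<close>
  times a power of the subsum over sets inside \<open>P j\<close>. The induction hypothesis for that
  subfamily, followed by the packing condition at \<open>P j\<close>, turns its integral into a
  multiple of \<open>L ^ Suc n * measure M (P j)\<close>. The integer factors multiply to the
  factorial.\<close>

lemma carleson_embedding_power:
  fixes c :: "'i \<Rightarrow> real"
  assumes "finite F" "\<And>i. i \<in> F \<Longrightarrow> 0 \<le> c i" "\<And>i. i \<in> F \<Longrightarrow> P i \<in> sets M"
    "\<And>i. i \<in> F \<Longrightarrow> emeasure M (P i) < \<infinity>"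
    and nested: "\<And>i j. i \<in> F \<Longrightarrow> j \<in> F \<Longrightarrow> P i \<inter> P j \<noteq> {} \<Longrightarrow> P i \<subseteq> P j \<or> P j \<subseteq> P i"
    and L: "0 \<le> L"
    and carleson: "\<And>j. j \<in> F \<Longrightarrow>
      (\<Sum>i | i \<in> F \<and> P i \<subseteq> P j. c i * measure M (P i)) \<le> L * measure M (P j)"
  shows "(\<integral>x. (\<Sum>i\<in>F. c i * indicator (P i) x) ^ Suc n \<partial>M)
    \<le> fact (Suc n) * L ^ n * (\<Sum>i\<in>F. c i * measure M (P i))"
  using assms
proof (induction n arbitrary: F)
  case 0
  have "(\<integral>x. (\<Sum>i\<in>F. c i * indicator (P i) x) \<partial>M) = (\<Sum>i\<in>F. \<integral>x. c i * indicator (P i) x \<partial>M)"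
    using 0 by (intro Bochner_Integration.integral_sum integrable_mult_right integrable_real_indicator) auto
  also have "\<dots> = (\<Sum>i\<in>F. c i * measure M (P i))"
    using 0 by (intro sum.cong refl) simp
  finally show ?case by simp
next
  case (Suc n)
  let ?F = "\<lambda>j. {i. i \<in> F \<and> P i \<subseteq> P j}"
  let ?S = "\<lambda>G x. \<Sum>i\<in>G. c i * indicator (P i) x"
  have int: "integrable M (\<lambda>x. ?S G x ^ Suc m)" if "G \<subseteq> F" for G m
    using that Suc.prems finite_subset[OF that] by (intro integrable_indicator_sum_power) auto
  have ptw: "?S F x ^ Suc (Suc n) \<le> real (Suc (Suc n)) * (\<Sum>j\<in>F. c j * ?S (?F j) x ^ Suc n)" for x
  proof -
    let ?X = "{i \<in> F. x \<in> P i}"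
    have S: "?S G x = (\<Sum>i | i \<in> G \<and> x \<in> P i. c i)" if "G \<subseteq> F" for G
      using finite_subset[OF that Suc.prems(1)]
      by (simp add: indicator_def sum.If_cases Int_def if_distrib[of "\<lambda>a. _ * a"])
    have "(\<Sum>i\<in>?X. c i) ^ Suc (Suc n) \<le>
        real (Suc (Suc n)) * (\<Sum>j\<in>?X. c j * (\<Sum>i | i \<in> ?X \<and> P i \<subseteq> P j. c i) ^ Suc n)"
    \<comment> \<open>Sets sharing the point \<open>x\<close> meet each other, so here nestedness
      makes them a chain.\<close>
    proof (rule sum_power_le_chain)
      show "P i \<subseteq> P j \<or> P j \<subseteq> P i" if "i \<in> ?X" "j \<in> ?X" for i j
        using that by (intro Suc.prems(5)) auto
    qed (use Suc.prems in auto)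
    also have "\<dots> = real (Suc (Suc n)) * (\<Sum>j\<in>?X. c j * ?S (?F j) x ^ Suc n)"
    proof -
      have "{i. i \<in> ?X \<and> P i \<subseteq> P j} = {i. i \<in> ?F j \<and> x \<in> P i}" for j by auto
      then show ?thesis by (subst S) auto
    qed
    also have "\<dots> \<le> real (Suc (Suc n)) * (\<Sum>j\<in>F. c j * ?S (?F j) x ^ Suc n)"
      using Suc.prems
      by (intro mult_left_mono sum_mono2) (auto intro!: mult_nonneg_nonneg zero_le_power sum_nonneg)
    finally show ?thesis by (subst S) auto
  qed
  have "(\<integral>x. ?S F x ^ Suc (Suc n) \<partial>M) \<le>
      (\<integral>x. real (Suc (Suc n)) * (\<Sum>j\<in>F. c j * ?S (?F j) x ^ Suc n) \<partial>M)"
    using ptw by (intro integral_mono int integrable_mult_right Bochner_Integration.integrable_sum) auto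
  also have "\<dots> = real (Suc (Suc n)) * (\<Sum>j\<in>F. c j * (\<integral>x. ?S (?F j) x ^ Suc n \<partial>M))"
  proof -
    have "(\<integral>x. (\<Sum>j\<in>F. c j * ?S (?F j) x ^ Suc n) \<partial>M) = (\<Sum>j\<in>F. \<integral>x. c j * ?S (?F j) x ^ Suc n \<partial>M)"
      by (intro Bochner_Integration.integral_sum integrable_mult_right int) auto
    then show ?thesis by simp
  qed
  also have "\<dots> \<le> real (Suc (Suc n)) * (\<Sum>j\<in>F. c j * (fact (Suc n) * L ^ Suc n * measure M (P j)))"
  proof (intro mult_left_mono sum_mono)
    fix j assume j: "j \<in> F"
    have "(\<integral>x. ?S (?F j) x ^ Suc n \<partial>M)
        \<le> fact (Suc n) * L ^ n * (\<Sum>i\<in>?F j. c i * measure M (P i))"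
    proof (rule Suc.IH)
      fix l assume l: "l \<in> ?F j"
      have "(\<Sum>i | i \<in> ?F j \<and> P i \<subseteq> P l. c i * measure M (P i))
          \<le> (\<Sum>i | i \<in> F \<and> P i \<subseteq> P l. c i * measure M (P i))"
        using Suc.prems by (intro sum_mono2) auto
      also have "\<dots> \<le> L * measure M (P l)" using Suc.prems l by auto
      finally show "(\<Sum>i | i \<in> ?F j \<and> P i \<subseteq> P l. c i * measure M (P i)) \<le> L * measure M (P l)" .
    qed (use Suc.prems in auto)
    also have "\<dots> \<le> fact (Suc n) * L ^ n * (L * measure M (P j))"
      using Suc.prems j by (intro mult_left_mono) auto
    finally show "(\<integral>x. ?S (?F j) x ^ Suc n \<partial>M) \<le> fact (Suc n) * L ^ Suc n * measure M (P j)"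
      by (simp add: algebra_simps)
  qed (use Suc.prems in auto)
  also have "\<dots> = fact (Suc (Suc n)) * L ^ Suc n * (\<Sum>i\<in>F. c i * measure M (P i))"
    unfolding fact_Suc[of "Suc n"] sum_distrib_left by (intro sum.cong refl) (simp only: ac_simps of_nat_mult)
  finally show ?case .
qed

section \<open>Countable sums as limits of finite sums\<close>

lemma countable_exhaustion:
  assumes "countable I"
  obtains F :: "nat \<Rightarrow> 'i set" where "incseq F" "\<And>n. finite (F n)" "(\<Union>n. F n) = I"
proof
  let ?F = "\<lambda>n. {i \<in> I. to_nat_on I i < n}"
  show "incseq ?F" by (auto simp: incseq_def)
  show "finite (?F n)" for n
  proof (rule finite_imageD)
    show "finite (to_nat_on I ` ?F n)" by (rule finite_subset[of _ "{..<n}"]) auto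
    show "inj_on (to_nat_on I) (?F n)"
      using inj_on_to_nat_on[OF assms] by (rule inj_on_subset) auto
  qed
  show "(\<Union>n. ?F n) = I" by auto
qed

lemma filterlim_exhaustion:
  assumes "incseq F" "\<And>n. finite (F n)" "(\<Union>n. F n) = I"
  shows "filterlim F (finite_subsets_at_top I) sequentially"
  unfolding filterlim_finite_subsets_at_top
proof (intro allI impI)
  fix X assume X: "finite X \<and> X \<subseteq> I"
  have "\<forall>\<^sub>F n in sequentially. x \<in> F n" if x: "x \<in> X" for x
  proof -
    have "x \<in> (\<Union>n. F n)" using x X assms(3) by auto
    then obtain m where "x \<in> F m" by auto
    then show ?thesis
      using assms(1) by (auto simp: eventually_sequentially incseq_def)
  qed
  then have "\<forall>\<^sub>F n in sequentially. \<forall>x\<in>X. x \<in> F n"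
    using X by (intro eventually_ball_finite) auto
  then show "\<forall>\<^sub>F n in sequentially. finite (F n) \<and> X \<subseteq> F n \<and> F n \<subseteq> I"
    by eventually_elim (use assms in auto)
qed

lemma infsum_exhaustion:
  assumes "incseq F" "\<And>n. finite (F n)" "(\<Union>n. F n) = I" "f summable_on I"
  shows "(\<lambda>n. \<Sum>i\<in>F n. f i) \<longlonglongrightarrow> infsum f I"
  using has_sum_infsum[OF assms(4)] unfolding has_sum_def
  by (rule filterlim_compose[OF _ filterlim_exhaustion[OF assms(1-3)]])

text \<open>Real families are summable exactly if absolutely summable, and partial sums of absolute
  values along one exhaustion already decide this. The countable supremum is measurable in a
  parameter and open to monotone convergence.\<close>

lemma summable_on_iff_exhaustion:
  fixes f :: "'i \<Rightarrow> real"
  assumes F: "incseq F" "\<And>n. finite (F n)" "(\<Union>n. F n) = I"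
  shows "f summable_on I \<longleftrightarrow> (SUP n. ennreal (\<Sum>i\<in>F n. \<bar>f i\<bar>)) < \<infinity>"
proof
  assume "f summable_on I"
  then have s: "(\<lambda>i. \<bar>f i\<bar>) summable_on I"
    unfolding real_norm_def[symmetric] by (rule iffD1[OF summable_on_iff_abs_summable_on_real])
  have "(\<Sum>i\<in>F n. \<bar>f i\<bar>) \<le> infsum (\<lambda>i. \<bar>f i\<bar>) I" for n
    using s F by (intro finite_sum_le_infsum) auto
  then have "(SUP n. ennreal (\<Sum>i\<in>F n. \<bar>f i\<bar>)) \<le> ennreal (infsum (\<lambda>i. \<bar>f i\<bar>) I)"
    by (intro SUP_least ennreal_leI)
  also have "\<dots> < \<infinity>" by simp
  finally show "(SUP n. ennreal (\<Sum>i\<in>F n. \<bar>f i\<bar>)) < \<infinity>" .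
next
  assume "(SUP n. ennreal (\<Sum>i\<in>F n. \<bar>f i\<bar>)) < \<infinity>"
  then obtain K where K: "(SUP n. ennreal (\<Sum>i\<in>F n. \<bar>f i\<bar>)) = ennreal K" "0 \<le> K"
    using less_top_ennreal[of "SUP n. ennreal (\<Sum>i\<in>F n. \<bar>f i\<bar>)"] by (auto simp only: infinity_ennreal_def)
  have "(\<Sum>i\<in>X. \<bar>f i\<bar>) \<le> K" if X: "X \<subseteq> I" "finite X" for X
  proof -
    have "\<forall>\<^sub>F n in sequentially. finite (F n) \<and> X \<subseteq> F n \<and> F n \<subseteq> I"
      using filterlim_exhaustion[OF F] X
      unfolding filterlim_finite_subsets_at_top by blast
    then obtain n where n: "X \<subseteq> F n"
      using eventually_happens'[OF sequentially_bot] by blast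
    have "(\<Sum>i\<in>X. \<bar>f i\<bar>) \<le> (\<Sum>i\<in>F n. \<bar>f i\<bar>)"
      using n F by (intro sum_mono2) auto
    moreover have "ennreal (\<Sum>i\<in>F n. \<bar>f i\<bar>) \<le> ennreal K"
      unfolding K(1)[symmetric] by (rule SUP_upper) simp
    ultimately show ?thesis using K(2) by (simp add: ennreal_le_iff)
  qed
  then have "(\<lambda>i. \<bar>f i\<bar>) summable_on I"
    by (intro nonneg_bdd_above_summable_on) (auto simp: bdd_above_def)
  then show "f summable_on I"
    unfolding real_norm_def[symmetric] by (rule iffD2[OF summable_on_iff_abs_summable_on_real])
qed

text \<open>\<open>infsum\<close> is 0 where the family is not summable, although the partial sums
  may well converge there. Cutting them off outside the measurable set \<open>D\<close> of
  summability makes them converge to \<open>infsum\<close> everywhere.\<close>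

lemma borel_measurable_infsum_countable:
  fixes u :: "'i \<Rightarrow> 'a \<Rightarrow> real"
  assumes "countable I" and u: "\<And>i. i \<in> I \<Longrightarrow> u i \<in> borel_measurable M"
  shows "(\<lambda>x. \<Sum>\<^sub>\<infinity>i\<in>I. u i x) \<in> borel_measurable M"
proof -
  obtain F :: "nat \<Rightarrow> 'i set" where F: "incseq F" "\<And>n. finite (F n)" "(\<Union>n. F n) = I"
    using countable_exhaustion[OF assms(1)] by metis
  have [measurable]: "u i \<in> borel_measurable M" if "i \<in> F n" for i n
    using u F(3) that by blast
  define D where "D = {x \<in> space M. (SUP n. ennreal (\<Sum>i\<in>F n. \<bar>u i x\<bar>)) < \<infinity>}"
  have [measurable]: "D \<in> sets M" unfolding D_def by measurable
  show ?thesis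
  proof (rule borel_measurable_LIMSEQ_real)
    show "(\<lambda>x. (\<Sum>i\<in>F n. u i x) * indicator D x) \<in> borel_measurable M" for n
      by measurable
    fix x assume "x \<in> space M"
    then have "x \<in> D \<longleftrightarrow> (\<lambda>i. u i x) summable_on I"
      by (simp add: D_def summable_on_iff_exhaustion[OF F])
    then show "(\<lambda>n. (\<Sum>i\<in>F n. u i x) * indicator D x) \<longlonglongrightarrow> (\<Sum>\<^sub>\<infinity>i\<in>I. u i x)"
      using infsum_exhaustion[OF F, of "\<lambda>i. u i x"]
      by (cases "x \<in> D") (simp_all add: infsum_not_exists)
  qed
qed

lemma add_power_le_2:
  fixes a b :: real
  assumes "0 \<le> a" "0 \<le> b"
  shows "(a + b) ^ n \<le> 2 ^ n * (a ^ n + b ^ n)"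
proof -
  have "(a + b) ^ n \<le> (2 * max a b) ^ n"
    using assms by (intro power_mono) auto
  also have "\<dots> \<le> 2 ^ n * (a ^ n + b ^ n)"
    using assms by (auto simp: power_mult_distrib max_def)
  finally show ?thesis .
qed

lemma powr_le_add_power:
  fixes t p :: real
  assumes "0 \<le> t" "1 \<le> p" "p \<le> real k"
  shows "t powr p \<le> t + t ^ k"
proof (cases "t \<le> 1")
  case True
  then have "t powr p \<le> t powr 1"
    using assms by (intro powr_mono') auto
  then show ?thesis using assms by (simp add: add_increasing2)
next
  case False
  then have "t powr p \<le> t powr real k"
    using assms by (intro powr_mono) auto
  then show ?thesis using False assms by (simp add: powr_realpow add_increasing)
qed

section \<open>The selected cubes\<close>

locale calderon_zygmund =
  fixes d :: nat and M :: "(nat \<Rightarrow> real) measure" and f :: "(nat \<Rightarrow> real) \<Rightarrow> real"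
    and s :: "nat \<Rightarrow> bool" and lam :: real
  assumes d_ge_1: "1 \<le> d"
    and sets_M: "sets M = sets (PiM {..<d} (\<lambda>_. borel :: real measure))"
    and finite_dyadic: "\<And>Q. dyadic d Q \<Longrightarrow> emeasure M Q < \<infinity>"
    and integrable_f: "integrable M f"
    and support_f: "\<And>x. x \<in> space M \<Longrightarrow> x \<notin> quadrant d s \<Longrightarrow> f x = 0"
    and lam_gt: "avg M (quadrant d s) (\<lambda>x. \<bar>f x\<bar>) < lam"
begin

lemma space_M: "space M = Rd d"
  using space_Rd[OF sets_M] .

lemma dyadic_sets [measurable]: "dyadic d Q \<Longrightarrow> Q \<in> sets M"
  using dyadic_measurable[OF sets_M] .

lemma measurable_f [measurable]: "f \<in> borel_measurable M"
  using integrable_f by simp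

lemma avg_abs_nonneg: "0 \<le> avg M A (\<lambda>x. \<bar>f x\<bar>)"
  unfolding avg_def set_lebesgue_integral_def by (auto intro!: divide_nonneg_nonneg integral_nonneg_AE)

text \<open>The average in \<open>lam_gt\<close> is nonnegative, also in the default cases where it
  is 0.\<close>

lemma lam_pos: "0 < lam"
  using avg_abs_nonneg lam_gt by (rule le_less_trans)

text \<open>The finite measure |f| \<mu>. It turns conditions on averages into inequalities between
  measures, which can be summed over disjoint cubes.\<close>

definition N :: "(nat \<Rightarrow> real) measure" where
  "N = density M (\<lambda>x. ennreal \<bar>f x\<bar>)"

lemma sets_N [simp, measurable_cong]: "sets N = sets M" and space_N [simp]: "space N = space M"
  by (simp_all add: N_def)

lemma emeasure_N: "A \<in> sets M \<Longrightarrow> emeasure N A = ennreal (LINT x:A|M. \<bar>f x\<bar>)"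
proof -
  assume [measurable]: "A \<in> sets M"
  have "emeasure N A = (\<integral>\<^sup>+x. ennreal (\<bar>f x\<bar> * indicator A x) \<partial>M)"
    unfolding N_def by (subst emeasure_density) (auto intro!: nn_integral_cong split: split_indicator)
  also have "\<dots> = ennreal (\<integral>x. \<bar>f x\<bar> * indicator A x \<partial>M)"
    using integrable_f by (intro nn_integral_eq_integral integrable_real_mult_indicator) auto
  finally show ?thesis
    by (simp add: set_lebesgue_integral_def mult.commute)
qed

sublocale N: finite_measure N
  by standard (simp add: emeasure_N)

lemma measure_N: "A \<in> sets M \<Longrightarrow> measure N A = (LINT x:A|M. \<bar>f x\<bar>)"
  unfolding measure_def emeasure_N set_lebesgue_integral_def by (auto intro!: integral_nonneg_AE)

lemma measure_N_space: "measure N (space M) = (\<integral>x. \<bar>f x\<bar> \<partial>M)"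
  unfolding measure_N[OF sets.top] set_lebesgue_integral_def
  by (intro Bochner_Integration.integral_cong) auto

lemma emeasure_dyadic: "dyadic d Q \<Longrightarrow> emeasure M Q = ennreal (measure M Q)"
  using finite_dyadic[of Q] by (simp add: emeasure_eq_ennreal_measure less_top)

text \<open>On a cube of \<mu>-measure 0 both sides hold: the average is 0 by default, and
  \<open>N\<close> is absolutely continuous.\<close>

lemma avg_le_iff:
  assumes "dyadic d Q"
  shows "avg M Q (\<lambda>x. \<bar>f x\<bar>) \<le> lam \<longleftrightarrow> measure N Q \<le> lam * measure M Q"
proof (cases "emeasure M Q = 0")
  case True
  then have "emeasure N Q = 0"
    unfolding N_def using dyadic_sets[OF assms]
    by (intro absolutely_continuousD[OF absolutely_continuousI_density])
       (auto simp: null_sets_def)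
  then have "measure N Q = 0" by (simp add: measure_def)
  with True show ?thesis
    using lam_pos by (simp add: avg_def)
next
  case False
  then have "0 < measure M Q"
    using emeasure_dyadic[OF assms] by (simp add: zero_less_measure_iff)
  moreover have "emeasure M Q \<noteq> \<infinity>"
    using finite_dyadic[OF assms] by auto
  ultimately show ?thesis
    using False
    by (simp add: avg_def measure_N[OF dyadic_sets[OF assms]] pos_divide_le_eq)
qed

section \<open>Maximal cubes and the level set\<close>

definition cubes :: "(nat \<Rightarrow> real) set set" where
  "cubes = {Q. dyadic d Q \<and> lam < avg M Q (\<lambda>x. \<bar>f x\<bar>) \<and>
     (\<forall>Q'. dyadic d Q' \<and> Q \<subset> Q' \<longrightarrow> avg M Q' (\<lambda>x. \<bar>f x\<bar>) \<le> lam)}"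

definition Om :: "(nat \<Rightarrow> real) set" where
  "Om = {x \<in> space M. ereal lam < dmax d M f x}"

lemma cubes_dyadic: "Q \<in> cubes \<Longrightarrow> dyadic d Q"
  by (simp add: cubes_def)

lemma cubes_sets [measurable]: "Q \<in> cubes \<Longrightarrow> Q \<in> sets M"
  by (simp add: cubes_dyadic dyadic_sets)

lemma countable_cubes: "countable cubes"
  by (rule countable_subset[OF _ countable_dyadic[of d]]) (auto simp: cubes_def)

lemma measure_N_gt: "Q \<in> cubes \<Longrightarrow> lam * measure M Q < measure N Q"
  using avg_le_iff[of Q] by (auto simp: cubes_def)

lemma measure_cube_pos: assumes "Q \<in> cubes" shows "0 < measure M Q"
proof -
  have "0 < avg M Q (\<lambda>x. \<bar>f x\<bar>)"
    using assms lam_pos by (auto simp: cubes_def)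
  then show ?thesis
    using emeasure_dyadic[OF cubes_dyadic[OF assms]]
    by (auto simp: avg_def zero_less_measure_iff split: if_splits)
qed

lemma disjoint_cubes: "disjoint cubes"
proof (rule disjointI)
  fix P Q assume PQ: "P \<in> cubes" "Q \<in> cubes" "P \<noteq> Q"
  show "P \<inter> Q = {}"
  proof (rule ccontr)
    assume "P \<inter> Q \<noteq> {}"
    then have "P \<subset> Q \<or> Q \<subset> P"
      using dyadic_nested[of d P Q] PQ cubes_dyadic by blast
    then show False
      using PQ unfolding cubes_def by force
  qed
qed

text \<open>A cube charged by |f| \<mu> must meet the quadrant that supports \<open>f\<close>, and a
  dyadic cube meeting a quadrant lies inside it.\<close>

lemma in_quadrant:
  assumes "dyadic d Q" "0 < measure N Q"
  shows "Q \<subseteq> quadrant d s"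
proof -
  have "\<exists>x\<in>Q. x \<in> quadrant d s"
  proof (rule ccontr)
    assume *: "\<not> (\<exists>x\<in>Q. x \<in> quadrant d s)"
    have "(LINT x:Q|M. \<bar>f x\<bar>) = (\<integral>x. 0 \<partial>M)"
      unfolding set_lebesgue_integral_def
      using * support_f by (intro Bochner_Integration.integral_cong) (auto split: split_indicator)
    then show False
      using assms measure_N[OF dyadic_sets[OF assms(1)]] by simp
  qed
  then show ?thesis
    using dyadic_subset_quadrant assms by blast
qed

lemma cubes_subset_quadrant: "Q \<in> cubes \<Longrightarrow> Q \<subseteq> quadrant d s"
proof (rule in_quadrant)
  assume Q: "Q \<in> cubes"
  show "0 < measure N Q"
    using measure_N_gt[OF Q] measure_cube_pos[OF Q] lam_pos by (smt (verit) mult_pos_pos)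
qed (simp add: cubes_dyadic)

lemma quadrant_sets: "quadrant d s \<in> sets M"
proof -
  note measurable_coordinate[OF sets_M, measurable]
  have "quadrant d s = {x \<in> space M. \<forall>i\<in>{..<d}. if s i then 0 \<le> x i else x i < 0}"
    by (auto simp: quadrant_def space_M)
  also have "\<dots> \<in> sets M"
    by (intro sets.sets_Collect_finite_All) auto
  finally show ?thesis .
qed

text \<open>Continuity from below gives an ancestor \<open>?D n\<close> for which \<open>lam\<close>
  times its \<mu>-measure exceeds the total mass of \<open>N\<close>. Larger ancestors have at least
  as much \<mu>-measure, so they inherit this. Positivity of the starting cube excludes a null
  quadrant, where the default average 0 would give no information.\<close>

lemma ancestors_eventually_small:
  assumes x: "x \<in> quadrant d s" and pos: "0 < measure M (dcube d k x)"
  shows "\<exists>n. \<forall>m\<ge>n. measure N (dcube d (k - int m) x) \<le> lam * measure M (dcube d (k - int m) x)"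
proof -
  let ?R = "quadrant d s" and ?D = "\<lambda>n. dcube d (k - int n) x"
  have "?D 0 \<subseteq> ?R"
    using dyadic_subset_quadrant[OF dyadic_dcube dcube_self x] x by (simp add: quadrant_def)
  then have Rpos: "emeasure M ?R \<noteq> 0"
    using pos emeasure_mono[of "?D 0" ?R M] quadrant_sets
    by (auto simp: emeasure_dyadic[OF dyadic_dcube])
  have "emeasure N (space M) = emeasure N ?R"
    unfolding N_def using support_f quadrant_sets
    by (auto simp: emeasure_density intro!: nn_integral_cong split: split_indicator)
  also have "\<dots> < ennreal lam * emeasure M ?R"
  \<comment> \<open>The clauses of \<open>avg\<close>: against an infinite quadrant the finite mass
    of \<open>N\<close> loses at once, and for a finite one the inequality is
    \<open>lam_gt\<close>.\<close>
  proof (cases "emeasure M ?R = \<infinity>")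
    case True
    then show ?thesis
      using lam_pos N.emeasure_finite[of ?R] by (simp add: ennreal_mult_top less_top[symmetric])
  next
    case False
    then have fin: "emeasure M ?R = ennreal (measure M ?R)" by (simp add: emeasure_eq_ennreal_measure)
    then have "0 < measure M ?R" using Rpos by (simp add: zero_less_measure_iff)
    moreover have "measure N ?R / measure M ?R < lam"
      using lam_gt False Rpos by (simp add: avg_def measure_N[OF quadrant_sets])
    ultimately have "measure N ?R < lam * measure M ?R"
      by (simp add: pos_divide_less_eq)
    then show ?thesis
      unfolding fin N.emeasure_eq_measure using lam_pos
      by (simp add: ennreal_mult[symmetric] ennreal_less_iff)
  qed
  also have "ennreal lam * emeasure M ?R \<le> ennreal lam * emeasure M (\<Union>n. ?D n)"
    by (intro mult_left_mono emeasure_mono quadrant_subset_UN_dcube x sets.countable_UN)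
       (auto intro: dyadic_sets dyadic_dcube)
  also have "emeasure M (\<Union>n. ?D n) = (SUP n. emeasure M (?D n))"
    by (intro SUP_emeasure_incseq[symmetric] incseq_SucI dcube_antimono)
       (auto intro: dyadic_sets dyadic_dcube)
  also have "ennreal lam * (SUP n. emeasure M (?D n)) = (SUP n. ennreal lam * emeasure M (?D n))"
    by (simp add: SUP_mult_left_ennreal)
  finally obtain n where n: "emeasure N (space M) < ennreal lam * emeasure M (?D n)"
    by (auto simp: less_SUP_iff)
  show ?thesis
  proof (intro exI[of _ n] allI impI)
    fix m assume "n \<le> m"
    have "emeasure N (?D m) \<le> emeasure N (space M)"
      using emeasure_space[of N] by simp
    also note n
    also have "ennreal lam * emeasure M (?D n) \<le> ennreal lam * emeasure M (?D m)"
      using \<open>n \<le> m\<close> by (intro mult_left_mono emeasure_mono dcube_antimono dyadic_sets dyadic_dcube) auto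
    finally have "ennreal (measure N (?D m)) < ennreal (lam * measure M (?D m))"
      using lam_pos by (simp add: N.emeasure_eq_measure emeasure_dyadic[OF dyadic_dcube] ennreal_mult)
    then show "measure N (?D m) \<le> lam * measure M (?D m)"
      by (simp add: ennreal_less_iff)
  qed
qed

text \<open>The dyadic cubes through \<open>x\<close> above a given one form a sequence indexed by
  generations. Only finitely many of them have a large average, and the last of these is maximal
  among all dyadic cubes.\<close>

lemma Union_cubes: "\<Union>cubes = Om"
proof (intro equalityI subsetI)
  fix x assume "x \<in> \<Union>cubes"
  then obtain Q where Q: "Q \<in> cubes" "x \<in> Q" by auto
  have "ereal lam < ereal (avg M Q (\<lambda>y. \<bar>f y\<bar>))"
    using Q by (simp add: cubes_def)
  also have "\<dots> \<le> dmax d M f x"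
    unfolding dmax_def using Q by (intro SUP_upper) (auto simp: cubes_dyadic)
  finally show "x \<in> Om"
    using Q sets.sets_into_space[OF cubes_sets[OF Q(1)]] by (auto simp: Om_def)
next
  fix x assume "x \<in> Om"
  then obtain Q where Q: "dyadic d Q" "x \<in> Q" "lam < avg M Q (\<lambda>y. \<bar>f y\<bar>)"
    by (auto simp: Om_def dmax_def less_SUP_iff)
  obtain k where k: "Q = dcube d k x"
    using dyadic_eq_dcube Q by blast
  let ?D = "\<lambda>n. dcube d (k - int n) x"
  let ?big = "\<lambda>n. lam < avg M (?D n) (\<lambda>y. \<bar>f y\<bar>)"
  have big: "?big n \<longleftrightarrow> lam * measure M (?D n) < measure N (?D n)" for n
    using avg_le_iff[OF dyadic_dcube[of d "k - int n" x]] by (auto simp: not_le[symmetric])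
  have Npos: "0 < measure N Q"
    using big[of 0] Q k lam_pos by (smt (verit, best) measure_nonneg mult_nonneg_nonneg of_nat_0 diff_zero)
  have "0 < avg M Q (\<lambda>y. \<bar>f y\<bar>)" using Q lam_pos by linarith
  then have "0 < measure M (dcube d k x)"
    using emeasure_dyadic[OF Q(1)] k by (auto simp: avg_def zero_less_measure_iff split: if_splits)
  then obtain n where n: "\<forall>m\<ge>n. measure N (?D m) \<le> lam * measure M (?D m)"
    using ancestors_eventually_small in_quadrant[OF Q(1) Npos] Q(2) by blast
  have "?big 0" using Q k by simp
  moreover have "\<forall>m. ?big m \<longrightarrow> m \<le> n"
    using n big by (meson linorder_not_le nat_le_linear)
  ultimately obtain m where m: "?big m" "\<And>l. ?big l \<Longrightarrow> l \<le> m"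
    using GreatestI_nat[of ?big 0 n] Greatest_le_nat[of ?big _ n] by blast
  have xR: "x \<in> Rd d" using Q dyadic_subset_Rd by blast
  have "?D m \<in> cubes"
    unfolding cubes_def
  proof (intro CollectI conjI allI impI dyadic_dcube m(1))
    fix Q' assume Q': "dyadic d Q' \<and> ?D m \<subset> Q'"
    then have "x \<in> Q'" using dcube_self[OF xR, of "k - int m"] by auto
    then obtain l where l: "Q' = dcube d l x" using dyadic_eq_dcube Q' by blast
    have "l < k - int m"
    proof (rule ccontr)
      assume "\<not> l < k - int m"
      then have "Q' \<subseteq> ?D m" unfolding l by (intro dcube_antimono) simp
      with Q' show False by auto
    qed
    then have "Q' = ?D (nat (k - l))" "m < nat (k - l)" by (simp_all add: l)
    then show "avg M Q' (\<lambda>y. \<bar>f y\<bar>) \<le> lam"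
      using m(2)[of "nat (k - l)"] by force
  qed
  then show "x \<in> \<Union>cubes"
    using dcube_self[OF xR, of "k - int m"] by blast
qed

lemma Om_sets [measurable]: "Om \<in> sets M"
  unfolding Union_cubes[symmetric]
  using countable_cubes cubes_sets by (intro sets.countable_Union) auto

section \<open>The bound for f off the level set\<close>

lemma scale_algebra_sets: "scale_algebra d \<subseteq> sets M"
proof
  fix E assume "E \<in> scale_algebra d"
  then obtain n where "E = \<Union>(dcube d (int n) ` E)"
    by (rule scale_algebra_Union)
  also have "\<dots> \<in> sets M"
    using countable_dcube_image by (intro sets.countable_Union) (auto intro: dyadic_sets dyadic_dcube)
  finally show "E \<in> sets M" .
qed

text \<open>For the harder inclusion the identity map has to be measurable from the generated
  \<sigma>-algebra into the product. Coordinates are limits of rounded coordinates, and preimages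
  under the rounding at scale \<open>n\<close> are unions of cubes of that scale.\<close>

lemma sets_M_eq_sigma: "sets M = sigma_sets (space M) (scale_algebra d)"
proof
  show "sigma_sets (space M) (scale_algebra d) \<subseteq> sets M"
    by (intro sets.sigma_sets_subset scale_algebra_sets)
next
  define K where "K = sigma (Rd d) (scale_algebra d)"
  have pow: "scale_algebra d \<subseteq> Pow (Rd d)" by (auto simp: scale_algebra_def)
  have K: "space K = Rd d" "sets K = sigma_sets (Rd d) (scale_algebra d)"
    using pow by (simp_all add: K_def)
  have coord: "(\<lambda>x. x i) \<in> borel_measurable K" if i: "i < d" for i
  proof (rule borel_measurable_LIMSEQ_real[OF floor_scale_tendsto])
    fix n :: nat
    have "(\<lambda>x. \<lfloor>x i * 2 powr real n\<rfloor>) \<in> measurable K (count_space UNIV)"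
    proof (rule measurableI)
      fix A :: "int set"
      have "(\<lambda>x. \<lfloor>x i * 2 powr real n\<rfloor>) -` A \<inter> space K \<in> scale_algebra d"
        unfolding scale_algebra_def using i
        by (intro CollectI conjI exI[of _ n]) (auto simp: mem_dcube_iff K)
      then show "(\<lambda>x. \<lfloor>x i * 2 powr real n\<rfloor>) -` A \<inter> space K \<in> sets K"
        unfolding K by auto
    qed simp
    then have [measurable]: "(\<lambda>x. \<lfloor>x i * 2 powr real n\<rfloor>) \<in> measurable K (count_space UNIV)" .
    show "(\<lambda>x. real_of_int \<lfloor>x i * 2 powr real n\<rfloor> / 2 powr real n) \<in> borel_measurable K"
      by measurable
  qed
  have id: "(\<lambda>x. x) \<in> measurable K (PiM {..<d} (\<lambda>_. borel :: real measure))"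
  proof (rule measurable_PiM_single)
    show "(\<lambda>x. x) \<in> space K \<rightarrow> (\<Pi>\<^sub>E i\<in>{..<d}. space (borel :: real measure))"
      by (auto simp: K Rd_def)
    fix A :: "real set" and i assume "i \<in> {..<d}" "A \<in> sets borel"
    then show "{\<omega> \<in> space K. \<omega> i \<in> A} \<in> sets K"
      using measurable_sets[OF coord[of i], of A] by (simp add: vimage_def Int_def conj_commute)
  qed
  show "sets M \<subseteq> sigma_sets (space M) (scale_algebra d)"
  proof
    fix A assume "A \<in> sets M"
    then have "(\<lambda>x. x) -` A \<inter> space K \<in> sets K"
      using measurable_sets[OF id] sets_M by auto
    moreover have "A \<subseteq> Rd d"
      using sets.sets_into_space[OF \<open>A \<in> sets M\<close>] by (simp add: space_M)
    ultimately show "A \<in> sigma_sets (space M) (scale_algebra d)"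
      by (simp add: K space_M Int_absorb2)
  qed
qed

text \<open>The measure \<lambda> \<mu>, the partner of \<open>N\<close> in the comparisons.\<close>

definition L :: "(nat \<Rightarrow> real) measure" where
  "L = density M (\<lambda>_. ennreal lam)"

lemma sets_L [simp, measurable_cong]: "sets L = sets M"
  by (simp add: L_def)

lemma emeasure_L: "A \<in> sets M \<Longrightarrow> emeasure L A = ennreal lam * emeasure M A"
  by (simp add: L_def emeasure_density_const)

lemma emeasure_L_cube_le: "Q \<in> cubes \<Longrightarrow> emeasure L Q \<le> emeasure N Q"
  using measure_N_gt[of Q] lam_pos
  by (simp add: emeasure_L cubes_sets emeasure_dyadic[OF cubes_dyadic] N.emeasure_eq_measure
      ennreal_mult[symmetric] ennreal_le_iff)

lemma emeasure_finite_in_dyadic: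
  "dyadic d C \<Longrightarrow> A \<subseteq> C \<Longrightarrow> emeasure M A = ennreal (measure M A)"
  using emeasure_mono[of A C M] finite_dyadic[of C] dyadic_sets[of C]
  by (intro emeasure_eq_ennreal_measure) (auto simp: top_unique)

lemma avg_le_outside_Om: "dyadic d C \<Longrightarrow> x \<in> C \<Longrightarrow> x \<notin> Om \<Longrightarrow> avg M C (\<lambda>y. \<bar>f y\<bar>) \<le> lam"
proof -
  assume C: "dyadic d C" "x \<in> C" "x \<notin> Om"
  have "ereal (avg M C (\<lambda>y. \<bar>f y\<bar>)) \<le> dmax d M f x"
    unfolding dmax_def using C by (intro SUP_upper) auto
  also have "\<dots> \<le> ereal lam"
    using C sets.sets_into_space[OF dyadic_sets[OF C(1)]] by (auto simp: Om_def not_less)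
  finally show ?thesis by simp
qed

text \<open>
  If \<open>C\<close> is not contained in \<open>Om\<close>, then \<open>N C \<le> \<lambda> M C\<close>, whereas \<open>C \<inter> Om\<close> is a disjoint union of
  selected cubes, on which the opposite inequality holds. Subtract.
\<close>
lemma emeasure_diff_Om_le:
  assumes C: "dyadic d C"
  shows "emeasure N (C - Om) \<le> emeasure L (C - Om)"
proof (cases "C \<subseteq> Om")
  case True
  then show ?thesis by (simp add: Diff_eq_empty_iff[THEN iffD2])
next
  case False
  then obtain x where x: "x \<in> C" "x \<notin> Om" by blast
  have [measurable]: "C \<in> sets M" using C by (rule dyadic_sets)
  define S where "S = {Q \<in> cubes. Q \<subseteq> C}"
  have CS: "C \<inter> Om = \<Union>S"
  proof
    show "C \<inter> Om \<subseteq> \<Union>S"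
    proof
      fix y assume y: "y \<in> C \<inter> Om"
      then obtain Q where Q: "Q \<in> cubes" "y \<in> Q" using Union_cubes by blast
      then have "Q \<subseteq> C \<or> C \<subseteq> Q"
        using dyadic_nested[of d Q C] C y cubes_dyadic by blast
      \<comment> \<open>The other inclusion would put the point \<open>x\<close> of \<open>C\<close>
        into \<open>Om\<close>.\<close>
      then have "Q \<subseteq> C" using Q(1) x Union_cubes by blast
      then show "y \<in> \<Union>S" using Q by (auto simp: S_def)
    qed
    show "\<Union>S \<subseteq> C \<inter> Om"
      using Union_cubes by (auto simp: S_def)
  qed
  have "emeasure L (\<Union>S) \<le> emeasure N (\<Union>S)"
  proof (rule emeasure_UN_disjoint_mono)
    show "countable S" using countable_cubes by (rule countable_subset[rotated]) (auto simp: S_def)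
    show "disjoint S" using disjoint_cubes by (auto simp: S_def disjoint_def)
    show "emeasure L Q \<le> emeasure N Q" if "Q \<in> S" for Q
      using that by (simp add: S_def emeasure_L_cube_le)
  qed (auto simp: S_def)
  then have "ennreal (lam * measure M (C \<inter> Om)) \<le> ennreal (measure N (C \<inter> Om))"
    unfolding CS[symmetric] using lam_pos
    by (simp add: emeasure_L N.emeasure_eq_measure emeasure_finite_in_dyadic[OF C] ennreal_mult)
  then have 1: "lam * measure M (C \<inter> Om) \<le> measure N (C \<inter> Om)"
    by (simp add: ennreal_le_iff)
  have 2: "measure N C \<le> lam * measure M C"
    using avg_le_outside_Om[OF C x] avg_le_iff[OF C] by simp
  have 3: "measure N (C - Om) = measure N C - measure N (C \<inter> Om)"
    using N.finite_measure_Diff[of C "C \<inter> Om"] by (simp add: Diff_Int2[symmetric] Diff_Int)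
  have 4: "measure M (C - Om) = measure M C - measure M (C \<inter> Om)"
    using measure_Diff[of M C "C \<inter> Om"] finite_dyadic[OF C] by (simp add: Diff_Int)
  have "measure N (C - Om) \<le> lam * measure M (C - Om)"
    using 1 2 unfolding 3 4 by (simp add: algebra_simps)
  then show ?thesis
    using lam_pos
    by (simp add: emeasure_L N.emeasure_eq_measure emeasure_finite_in_dyadic[OF C] ennreal_mult[symmetric]
        ennreal_le_iff)
qed

text \<open>Apply \<open>AE_nonpos_from_algebra\<close> to |f| - \<lambda> cut off to
  \<open>B - Om\<close>. The restriction to a cube \<open>B\<close> of scale 0 is needed for
  integrability of the constant, since \<mu> may be infinite; countably many such \<open>B\<close>
  cover the space.\<close>

lemma AE_le_lam: "AE x in M. x \<notin> Om \<longrightarrow> \<bar>f x\<bar> \<le> lam"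
proof -
  have "AE x in M. x \<in> B \<longrightarrow> x \<notin> Om \<longrightarrow> \<bar>f x\<bar> \<le> lam" if B0: "B \<in> dcube d 0 ` Rd d" for B
  proof -
    obtain a where B: "B = dcube d 0 a" using B0 by blast
    have dB: "dyadic d B" by (simp add: B dyadic_dcube)
    have [measurable]: "B \<in> sets M" using dB by (rule dyadic_sets)
    have int: "integrable M (\<lambda>x. \<bar>f x\<bar> * indicator A x)" "integrable M (\<lambda>x. lam * indicator A x)"
      if "A \<subseteq> B" "A \<in> sets M" for A
      using integrable_f that emeasure_finite_in_dyadic[OF dB, of A]
      by (auto intro!: integrable_real_mult_indicator)
    define w where "w x = (\<bar>f x\<bar> - lam) * indicator (B - Om) x" for x
    have w_eq: "w x * indicator E x = \<bar>f x\<bar> * indicator (E \<inter> B - Om) x - lam * indicator (E \<inter> B - Om) x" for x E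
      by (auto simp: w_def algebra_simps split: split_indicator)
    have "AE x in M. w x \<le> 0"
    proof (rule AE_nonpos_from_algebra)
      show "algebra (space M) (scale_algebra d)"
        using algebra_scale_algebra by (simp add: space_M)
      show "sets M = sigma_sets (space M) (scale_algebra d)" by (rule sets_M_eq_sigma)
      have "integrable M (\<lambda>x. \<bar>f x\<bar> * indicator (B - Om) x - lam * indicator (B - Om) x)"
        by (intro Bochner_Integration.integrable_diff int) auto
      then show "integrable M w" by (simp add: w_def[abs_def] algebra_simps)
      fix E assume E: "E \<in> scale_algebra d"
      then have [measurable]: "E \<in> sets M" using scale_algebra_sets by auto
      obtain n where n: "E = \<Union>(dcube d (int n) ` E)"
        using E by (rule scale_algebra_Union)
      let ?A = "E \<inter> B - Om"
      define S where "S = (\<lambda>C. C - Om) ` {C \<in> dcube d (int n) ` E. C \<subseteq> B}"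
      have "?A = \<Union>S"
      proof
        show "?A \<subseteq> \<Union>S"
        proof
          fix y assume y: "y \<in> ?A"
          then obtain e where e: "e \<in> E" "y \<in> dcube d (int n) e" using n by blast
          \<comment> \<open>Scales in the algebra are nonnegative, so its cubes refine the grid of
            scale 0: a cube meeting \<open>B\<close> lies in \<open>B\<close>.\<close>
          have "dcube d (int n) y \<subseteq> dcube d 0 y" by (rule dcube_antimono) simp
          then have "dcube d (int n) e \<subseteq> B"
            using y dcube_cong[OF e(2)] dcube_cong[of y d 0 a] by (simp add: B)
          then show "y \<in> \<Union>S" using y e by (auto simp: S_def)
        qed
        show "\<Union>S \<subseteq> ?A" using n by (auto simp: S_def)
      qed
      moreover have "emeasure N (\<Union>S) \<le> emeasure L (\<Union>S)"
      proof (rule emeasure_UN_disjoint_mono)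
        show "countable S"
          unfolding S_def by (intro countable_image countable_subset[OF _ countable_dcube_image]) auto
        show "S \<subseteq> sets N" by (auto simp: S_def intro!: sets.Diff Om_sets dyadic_sets[OF dyadic_dcube])
        show "emeasure N C \<le> emeasure L C" if "C \<in> S" for C
          using that by (auto simp: S_def intro!: emeasure_diff_Om_le dyadic_dcube)
        show "disjoint S"
        proof (rule disjointI)
          fix C D assume CD: "C \<in> S" "D \<in> S" "C \<noteq> D"
          then obtain y z where yz: "C = dcube d (int n) y - Om" "D = dcube d (int n) z - Om"
            by (auto simp: S_def)
          show "C \<inter> D = {}"
          proof (rule ccontr)
            assume "C \<inter> D \<noteq> {}"
            then obtain u where "u \<in> dcube d (int n) y" "u \<in> dcube d (int n) z" using yz by blast
            then have "dcube d (int n) y = dcube d (int n) z" using dcube_cong by metis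
            then show False using yz CD(3) by simp
          qed
        qed
      qed simp
      ultimately have "emeasure N ?A \<le> emeasure L ?A" by (simp only:)
      moreover have "emeasure L ?A = ennreal lam * emeasure M ?A"
        by (rule emeasure_L) measurable
      moreover have "emeasure M ?A = ennreal (measure M ?A)"
        by (rule emeasure_finite_in_dyadic[OF dB]) auto
      ultimately have "ennreal (measure N ?A) \<le> ennreal (lam * measure M ?A)"
        using lam_pos by (simp only: N.emeasure_eq_measure) (simp add: ennreal_mult)
      then have "measure N ?A \<le> lam * measure M ?A" by (simp add: ennreal_le_iff lam_pos less_imp_le)
      moreover have "measure N ?A = (\<integral>x. \<bar>f x\<bar> * indicator ?A x \<partial>M)"
        by (simp add: measure_N set_lebesgue_integral_def mult.commute)
      moreover have "(\<integral>x. lam * indicator ?A x \<partial>M) = lam * measure M ?A"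
        by (simp add: Int_absorb2 sets.sets_into_space)
      moreover have "(\<integral>x. w x * indicator E x \<partial>M) = (\<integral>x. \<bar>f x\<bar> * indicator ?A x \<partial>M) - (\<integral>x. lam * indicator ?A x \<partial>M)"
        unfolding w_eq by (intro Bochner_Integration.integral_diff int) auto
      ultimately show "(\<integral>x. w x * indicator E x \<partial>M) \<le> 0" by linarith
    qed
    then show ?thesis
      by eventually_elim (auto simp: w_def)
  qed
  then have "AE x in M. \<forall>B\<in>dcube d 0 ` Rd d. x \<in> B \<longrightarrow> x \<notin> Om \<longrightarrow> \<bar>f x\<bar> \<le> lam"
    by (intro AE_ball_countable[THEN iffD2] countable_dcube_image) auto
  then show ?thesis
    using AE_space
  proof eventually_elim
    case (elim x)
    then show ?case using dcube_self[of x d 0] by (auto simp: space_M)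
  qed
qed

subsection \<open>Estimates for the pieces\<close>

abbreviation norm_f :: real where
  "norm_f \<equiv> \<integral>x. \<bar>f x\<bar> \<partial>M"

lemma sum_measure_N_le:
  assumes "finite F" "F \<subseteq> cubes" "\<And>Q. Q \<in> F \<Longrightarrow> Q \<subseteq> B" "B \<in> sets M"
  shows "(\<Sum>Q\<in>F. measure N Q) \<le> measure N B"
proof -
  have "disjoint F" using disjoint_cubes assms(2) by (auto simp: disjoint_def)
  then have "(\<Sum>Q\<in>F. emeasure N Q) \<le> emeasure N B"
    using assms by (intro sum_emeasure_disjoint_le) auto
  then show ?thesis
    by (simp add: N.emeasure_eq_measure sum_nonneg ennreal_le_iff)
qed

lemma sum_measure_N_le_norm:
  assumes "finite F" "F \<subseteq> cubes"
  shows "(\<Sum>Q\<in>F. measure N Q) \<le> norm_f"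
  using sum_measure_N_le[OF assms, of "space M"] assms(2) sets.sets_into_space[OF cubes_sets]
  by (auto simp: measure_N_space)

lemma set_integrable_f: "A \<in> sets M \<Longrightarrow> integrable M (\<lambda>x. f x * indicator A x)"
  using integrable_f by (rule integrable_real_mult_indicator[rotated])

lemma avg_mult_measure:
  assumes "dyadic d Q" "0 < measure M Q"
  shows "avg M Q f * measure M Q = (\<integral>x. f x * indicator Q x \<partial>M)"
  using assms emeasure_dyadic[OF assms(1)]
  by (simp add: avg_def set_lebesgue_integral_def mult.commute)

lemma abs_avg_mult_measure_le:
  assumes "dyadic d Q" "0 < measure M Q"
  shows "\<bar>avg M Q f\<bar> * measure M Q \<le> measure N Q"
proof -
  have "\<bar>avg M Q f\<bar> * measure M Q = \<bar>\<integral>x. f x * indicator Q x \<partial>M\<bar>"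
    unfolding avg_mult_measure[OF assms, symmetric] by (simp add: abs_mult)
  also have "\<dots> \<le> (\<integral>x. \<bar>f x * indicator Q x\<bar> \<partial>M)"
    by (rule integral_abs_bound)
  also have "\<dots> = measure N Q"
    unfolding measure_N[OF dyadic_sets[OF assms(1)]] set_lebesgue_integral_def
    by (intro Bochner_Integration.integral_cong) (auto simp: abs_mult)
  finally show ?thesis .
qed

lemma dyadic_parent: "Q \<in> cubes \<Longrightarrow> dyadic d (dparent d Q)"
  using dyadic_dparent[OF d_ge_1 cubes_dyadic] .

lemma parent_sets [measurable]: "Q \<in> cubes \<Longrightarrow> dparent d Q \<in> sets M"
  by (intro dyadic_sets dyadic_parent)

lemma cube_subset_parent: "Q \<in> cubes \<Longrightarrow> Q \<subseteq> dparent d Q"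
  using psubset_dparent[OF d_ge_1 cubes_dyadic] by blast

lemma measure_parent_pos: assumes "Q \<in> cubes" shows "0 < measure M (dparent d Q)"
proof -
  have "measure M Q \<le> measure M (dparent d Q)"
    using assms cube_subset_parent finite_dyadic[OF dyadic_parent[OF assms]]
    by (intro measure_mono_fmeasurable) (auto simp: fmeasurable_def)
  then show ?thesis using measure_cube_pos[OF assms] by linarith
qed

text \<open>The parent is strictly larger, so maximality of \<open>Q\<close> applies to it. This is
  the source of both the bound for parent averages and the packing condition.\<close>

lemma measure_N_parent_le: "Q \<in> cubes \<Longrightarrow> measure N (dparent d Q) \<le> lam * measure M (dparent d Q)"
  using avg_le_iff[OF dyadic_parent] psubset_dparent[OF d_ge_1 cubes_dyadic] dyadic_parent
  by (auto simp: cubes_def)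

lemma abs_avg_parent_le: assumes "Q \<in> cubes" shows "\<bar>avg M (dparent d Q) f\<bar> \<le> lam"
proof -
  have "\<bar>avg M (dparent d Q) f\<bar> * measure M (dparent d Q) \<le> lam * measure M (dparent d Q)"
    using abs_avg_mult_measure_le[OF dyadic_parent measure_parent_pos] measure_N_parent_le assms
    by fastforce
  then show ?thesis using measure_parent_pos[OF assms] by simp
qed

text \<open>The value on \<open>Q\<close> of the martingale difference of \<open>f\<close> between
  the generations of \<open>Q\<close> and its parent.\<close>

definition jump :: "(nat \<Rightarrow> real) set \<Rightarrow> real" where
  "jump Q = avg M Q f - avg M (dparent d Q) f"

text \<open>The average over \<open>Q\<close> contributes at most \<open>measure N Q\<close>. The
  parent average is at most \<open>lam\<close>, and the stopping inequality pays for
  \<open>lam * measure M Q\<close> with a second \<open>measure N Q\<close>.\<close>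

lemma abs_jump_le: assumes "Q \<in> cubes" shows "\<bar>jump Q\<bar> * measure M Q \<le> 2 * measure N Q"
proof -
  have "\<bar>jump Q\<bar> * measure M Q \<le> (\<bar>avg M Q f\<bar> + lam) * measure M Q"
    using abs_avg_parent_le[OF assms] unfolding jump_def by (intro mult_right_mono) auto
  also have "\<dots> \<le> 2 * measure N Q"
    using abs_avg_mult_measure_le[OF cubes_dyadic measure_cube_pos, of Q] measure_N_gt[of Q] assms
    by (simp add: distrib_right)
  finally show ?thesis .
qed

lemma integrable_indicator_dyadic: "dyadic d Q \<Longrightarrow> integrable M (\<lambda>x. a * indicator Q x :: real)"
  using finite_dyadic[of Q] dyadic_sets[of Q]
  by (intro integrable_mult_right integrable_real_indicator) auto

lemma integral_indicator_dyadic: "dyadic d Q \<Longrightarrow> (\<integral>x. a * indicator Q x \<partial>M) = a * measure M Q"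
  using dyadic_sets[of Q] by (simp add: Int_absorb2 sets.sets_into_space)

lemma cz_b_eq: "cz_b d M f Q = (\<lambda>x. f x * indicator Q x - avg M Q f * indicator Q x)"
  by (auto simp: cz_b_def algebra_simps)

lemma integrable_cz_b: "Q \<in> cubes \<Longrightarrow> integrable M (cz_b d M f Q)"
  unfolding cz_b_eq
  by (intro Bochner_Integration.integrable_diff set_integrable_f integrable_indicator_dyadic cubes_dyadic cubes_sets)

lemma integral_cz_b: assumes "Q \<in> cubes" shows "(\<integral>x. cz_b d M f Q x \<partial>M) = 0"
proof -
  have "(\<integral>x. cz_b d M f Q x \<partial>M) = (\<integral>x. f x * indicator Q x \<partial>M) - (\<integral>x. avg M Q f * indicator Q x \<partial>M)"
    unfolding cz_b_eq using assms
    by (intro Bochner_Integration.integral_diff set_integrable_f integrable_indicator_dyadic cubes_dyadic cubes_sets)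
  then show ?thesis
    using avg_mult_measure[OF cubes_dyadic[OF assms] measure_cube_pos[OF assms]]
    by (simp only: integral_indicator_dyadic[OF cubes_dyadic[OF assms]])
qed

lemma nn_integral_cz_b_le:
  assumes Q: "Q \<in> cubes"
  shows "(\<integral>\<^sup>+x. ennreal \<bar>cz_b d M f Q x\<bar> \<partial>M) \<le> ennreal (2 * measure N Q)"
proof -
  have i: "integrable M (\<lambda>x. \<bar>f x * indicator Q x\<bar>)" "integrable M (\<lambda>x. \<bar>avg M Q f\<bar> * indicator Q x)"
    using Q by (intro integrable_abs set_integrable_f integrable_indicator_dyadic cubes_dyadic cubes_sets; assumption)+
  have "(\<integral>\<^sup>+x. ennreal \<bar>cz_b d M f Q x\<bar> \<partial>M) = ennreal (\<integral>x. \<bar>cz_b d M f Q x\<bar> \<partial>M)"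
    using integrable_cz_b[OF Q] by (intro nn_integral_eq_integral) auto
  also have "(\<integral>x. \<bar>cz_b d M f Q x\<bar> \<partial>M) \<le> (\<integral>x. \<bar>f x * indicator Q x\<bar> + \<bar>avg M Q f\<bar> * indicator Q x \<partial>M)"
    using integrable_cz_b[OF Q]
    by (intro integral_mono Bochner_Integration.integrable_add i) (auto simp: cz_b_eq split: split_indicator)
  also have "\<dots> = measure N Q + \<bar>avg M Q f\<bar> * measure M Q"
  proof -
    have "(\<integral>x. \<bar>f x * indicator Q x\<bar> \<partial>M) = measure N Q"
      unfolding measure_N[OF cubes_sets[OF Q]] set_lebesgue_integral_def
      by (intro Bochner_Integration.integral_cong) (auto simp: abs_mult)
    then show ?thesis
      by (simp only: Bochner_Integration.integral_add[OF i] integral_indicator_dyadic[OF cubes_dyadic[OF Q]])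
  qed
  also have "\<dots> \<le> 2 * measure N Q"
    using abs_avg_mult_measure_le[OF cubes_dyadic measure_cube_pos, of Q] Q by simp
  finally show ?thesis by (simp add: ennreal_leI)
qed

lemma cz_beta_eq: "cz_beta d M f Q =
   (\<lambda>x. jump Q * indicator Q x - jump Q * (measure M Q / measure M (dparent d Q)) * indicator (dparent d Q) x)"
  by (auto simp: cz_beta_def jump_def right_diff_distrib)

lemma integrable_cz_beta: "Q \<in> cubes \<Longrightarrow> integrable M (cz_beta d M f Q)"
  unfolding cz_beta_eq
  by (intro Bochner_Integration.integrable_diff integrable_indicator_dyadic cubes_dyadic dyadic_parent)

lemma integral_cz_beta: assumes "Q \<in> cubes" shows "(\<integral>x. cz_beta d M f Q x \<partial>M) = 0"
proof -
  have "(\<integral>x. cz_beta d M f Q x \<partial>M) = (\<integral>x. jump Q * indicator Q x \<partial>M)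
     - (\<integral>x. jump Q * (measure M Q / measure M (dparent d Q)) * indicator (dparent d Q) x \<partial>M)"
    unfolding cz_beta_eq using assms
    by (intro Bochner_Integration.integral_diff integrable_indicator_dyadic cubes_dyadic dyadic_parent)
  also have "\<dots> = 0"
    using measure_parent_pos[OF assms]
    by (simp only: integral_indicator_dyadic[OF cubes_dyadic[OF assms]]
        integral_indicator_dyadic[OF dyadic_parent[OF assms]]) simp
  finally show ?thesis .
qed

text \<open>The parts on \<open>Q\<close> and on its parent have the same norm
  \<open>\<bar>jump Q\<bar> * measure M Q\<close>, and each is at most
  \<open>2 * measure N Q\<close>.\<close>

lemma nn_integral_cz_beta_le:
  assumes Q: "Q \<in> cubes"
  shows "(\<integral>\<^sup>+x. ennreal \<bar>cz_beta d M f Q x\<bar> \<partial>M) \<le> ennreal (4 * measure N Q)"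
proof -
  let ?r = "measure M Q / measure M (dparent d Q)"
  have i: "integrable M (\<lambda>x. \<bar>jump Q\<bar> * indicator Q x)"
      "integrable M (\<lambda>x. (\<bar>jump Q\<bar> * ?r) * indicator (dparent d Q) x)"
    using Q by (intro integrable_indicator_dyadic cubes_dyadic dyadic_parent; assumption)+
  have "\<bar>cz_beta d M f Q x\<bar> \<le> \<bar>jump Q\<bar> * indicator Q x + (\<bar>jump Q\<bar> * ?r) * indicator (dparent d Q) x" for x
    unfolding cz_beta_eq by (rule order_trans[OF abs_triangle_ineq4]) (simp add: abs_mult)
  then have "(\<integral>x. \<bar>cz_beta d M f Q x\<bar> \<partial>M)
      \<le> (\<integral>x. \<bar>jump Q\<bar> * indicator Q x + (\<bar>jump Q\<bar> * ?r) * indicator (dparent d Q) x \<partial>M)"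
    using integrable_cz_beta[OF Q] by (intro integral_mono Bochner_Integration.integrable_add i) auto
  also have "\<dots> = \<bar>jump Q\<bar> * measure M Q + \<bar>jump Q\<bar> * ?r * measure M (dparent d Q)"
    by (simp only: Bochner_Integration.integral_add[OF i] integral_indicator_dyadic[OF cubes_dyadic[OF Q]]
        integral_indicator_dyadic[OF dyadic_parent[OF Q]])
  also have "\<dots> = 2 * (\<bar>jump Q\<bar> * measure M Q)"
    using measure_parent_pos[OF Q] by simp
  also have "\<dots> \<le> 4 * measure N Q"
    using abs_jump_le[OF Q] by (simp add: mult.commute)
  finally have "(\<integral>x. \<bar>cz_beta d M f Q x\<bar> \<partial>M) \<le> 4 * measure N Q" .
  moreover have "(\<integral>\<^sup>+x. ennreal \<bar>cz_beta d M f Q x\<bar> \<partial>M) = ennreal (\<integral>x. \<bar>cz_beta d M f Q x\<bar> \<partial>M)"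
    using integrable_cz_beta[OF Q] by (intro nn_integral_eq_integral) auto
  ultimately show ?thesis by (simp add: ennreal_leI)
qed

lemma infsum_cubes_le:
  fixes u :: "(nat \<Rightarrow> real) set \<Rightarrow> ennreal"
  assumes "\<And>Q. Q \<in> cubes \<Longrightarrow> u Q \<le> ennreal (a * measure N Q)" "0 \<le> a"
  shows "(\<Sum>\<^sub>\<infinity>Q\<in>cubes. u Q) \<le> ennreal (a * norm_f)"
proof (rule infsum_le_finite_sums)
  show "u summable_on cubes" by (rule nonneg_summable_on_complete) simp
  fix F assume F: "finite F" "F \<subseteq> cubes"
  have "sum u F \<le> (\<Sum>Q\<in>F. ennreal (a * measure N Q))"
    using assms F by (intro sum_mono) auto
  also have "\<dots> = ennreal (a * (\<Sum>Q\<in>F. measure N Q))"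
    using assms(2) by (simp add: sum_distrib_left)
  also have "\<dots> \<le> ennreal (a * norm_f)"
    using sum_measure_N_le_norm[OF F] assms(2) by (intro ennreal_leI mult_left_mono)
  finally show "sum u F \<le> ennreal (a * norm_f)" .
qed

section \<open>The overlapping parents\<close>

definition parent_sum :: "(nat \<Rightarrow> real) set set \<Rightarrow> (nat \<Rightarrow> real) \<Rightarrow> real" where
  "parent_sum F x = (\<Sum>Q\<in>F. measure N Q / measure M (dparent d Q) * indicator (dparent d Q) x)"

lemma integrable_parent_sum_power:
  assumes "finite F" "F \<subseteq> cubes"
  shows "integrable M (\<lambda>x. parent_sum F x ^ Suc n)"
  unfolding parent_sum_def using assms finite_dyadic[OF dyadic_parent]
  by (intro integrable_indicator_sum_power) auto

text \<open>Parents overlap, but the selected cubes do not: those whose parent lies in a given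
  parent are disjoint subsets of it, so their \<open>N\<close>-masses add up to at most that of the
  parent. This is the packing condition with constant \<open>lam\<close>.\<close>

lemma integral_parent_sum_power_le:
  assumes F: "finite F" "F \<subseteq> cubes"
  shows "(\<integral>x. parent_sum F x ^ Suc n \<partial>M) \<le> fact (Suc n) * lam ^ n * norm_f"
proof -
  have cM: "measure N Q / measure M (dparent d Q) * measure M (dparent d Q) = measure N Q" if "Q \<in> cubes" for Q
    using measure_parent_pos[OF that] by simp
  have "(\<integral>x. parent_sum F x ^ Suc n \<partial>M) \<le> fact (Suc n) * lam ^ n *
      (\<Sum>Q\<in>F. measure N Q / measure M (dparent d Q) * measure M (dparent d Q))"
    unfolding parent_sum_def
  proof (rule carleson_embedding_power)
    fix Q assume "Q \<in> F"
    then have Q: "Q \<in> cubes" using F by auto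
    show "emeasure M (dparent d Q) < \<infinity>" by (rule finite_dyadic[OF dyadic_parent[OF Q]])
    show "dparent d Q \<in> sets M" using Q by (rule parent_sets)
    show "dparent d Q \<subseteq> dparent d R \<or> dparent d R \<subseteq> dparent d Q"
      if "R \<in> F" "dparent d Q \<inter> dparent d R \<noteq> {}" for R
      using that F dyadic_nested[OF dyadic_parent[OF Q] dyadic_parent[of R]] by auto
    let ?G = "{R. R \<in> F \<and> dparent d R \<subseteq> dparent d Q}"
    have "(\<Sum>R\<in>?G. measure N R / measure M (dparent d R) * measure M (dparent d R)) = (\<Sum>R\<in>?G. measure N R)"
      using F by (intro sum.cong refl cM) auto
    also have "\<dots> \<le> measure N (dparent d Q)"
    proof (rule sum_measure_N_le)
      show "R \<subseteq> dparent d Q" if "R \<in> ?G" for R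
        using that F cube_subset_parent[of R] by auto
    qed (use F Q in auto)
    also have "\<dots> \<le> lam * measure M (dparent d Q)"
      using Q by (rule measure_N_parent_le)
    finally show "(\<Sum>R\<in>?G. measure N R / measure M (dparent d R) * measure M (dparent d R))
        \<le> lam * measure M (dparent d Q)" .
  qed (use F lam_pos in auto)
  also have "(\<Sum>Q\<in>F. measure N Q / measure M (dparent d Q) * measure M (dparent d Q)) = (\<Sum>Q\<in>F. measure N Q)"
    using F by (intro sum.cong refl cM) auto
  also have "fact (Suc n) * lam ^ n * (\<Sum>Q\<in>F. measure N Q) \<le> fact (Suc n) * lam ^ n * norm_f"
    using sum_measure_N_le_norm[OF F] lam_pos by (intro mult_left_mono) auto
  finally show ?thesis .
qed

text \<open>Disjointness leaves at most one nonzero term at each point.\<close>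

lemma
  fixes u :: "(nat \<Rightarrow> real) set \<Rightarrow> real"
  shows infsum_cubes_in: "\<And>Q. Q \<in> cubes \<Longrightarrow> x \<in> Q \<Longrightarrow> (\<Sum>\<^sub>\<infinity>P\<in>cubes. u P * indicator P x) = u Q"
    and infsum_cubes_out: "x \<notin> Om \<Longrightarrow> (\<Sum>\<^sub>\<infinity>P\<in>cubes. u P * indicator P x) = 0"
    and summable_on_cubes: "(\<lambda>P. u P * indicator P x) summable_on cubes"
proof -
  show out: "(\<Sum>\<^sub>\<infinity>P\<in>cubes. u P * indicator P x) = 0" if "x \<notin> Om"
    using that Union_cubes by (intro infsum_0) (auto simp: indicator_def)
  have single: "P = Q" if "P \<in> cubes" "x \<in> P" "Q \<in> cubes" "x \<in> Q" for P Q
    using that disjoint_cubes by (auto simp: disjoint_def)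
  show "(\<Sum>\<^sub>\<infinity>P\<in>cubes. u P * indicator P x) = u Q" if Q: "Q \<in> cubes" "x \<in> Q" for Q
  proof -
    have "(\<Sum>\<^sub>\<infinity>P\<in>cubes. u P * indicator P x) = (\<Sum>\<^sub>\<infinity>P\<in>{Q}. u P * indicator P x)"
      using single Q by (intro infsum_cong_neutral) (auto simp: indicator_def)
    then show ?thesis using Q by simp
  qed
  show "(\<lambda>P. u P * indicator P x) summable_on cubes"
  proof (cases "x \<in> Om")
    case True
    then obtain Q where Q: "Q \<in> cubes" "x \<in> Q" using Union_cubes by blast
    have "(\<lambda>P. u P * indicator P x) summable_on cubes \<longleftrightarrow> (\<lambda>P. u P * indicator P x) summable_on {Q}"
      using single Q by (intro summable_on_cong_neutral) (auto simp: indicator_def)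
    then show ?thesis by simp
  next
    case False
    then have "(\<lambda>P. u P * indicator P x) summable_on cubes \<longleftrightarrow> (\<lambda>P. 0 :: real) summable_on cubes"
      using Union_cubes by (intro summable_on_cong) (auto simp: indicator_def)
    then show ?thesis by simp
  qed
qed

text \<open>The part of the jump living on the parent, which \<open>cz_g\<close> adds and
  \<open>cz_beta\<close> subtracts.\<close>

definition tail :: "(nat \<Rightarrow> real) set \<Rightarrow> (nat \<Rightarrow> real) \<Rightarrow> real" where
  "tail Q x = jump Q * (measure M Q / measure M (dparent d Q)) * indicator (dparent d Q) x"

definition bounded_part :: "(nat \<Rightarrow> real) \<Rightarrow> real" where
  "bounded_part x = f x * indicator (space M - Om) x
     + (\<Sum>\<^sub>\<infinity>Q\<in>cubes. avg M (dparent d Q) f * indicator Q x)"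

lemma cz_g_eq: "cz_g d M f Om cubes x = bounded_part x + (\<Sum>\<^sub>\<infinity>Q\<in>cubes. tail Q x)"
  by (simp add: cz_g_def bounded_part_def tail_def jump_def)

lemma measurable_tail [measurable]: "Q \<in> cubes \<Longrightarrow> tail Q \<in> borel_measurable M"
  unfolding tail_def[abs_def] by measurable

lemma measurable_bounded_part [measurable]: "bounded_part \<in> borel_measurable M"
  unfolding bounded_part_def[abs_def]
  by (intro borel_measurable_add borel_measurable_infsum_countable countable_cubes) measurable

lemma measurable_cz_g: "cz_g d M f Om cubes \<in> borel_measurable M"
  unfolding cz_g_eq[abs_def]
  by (intro borel_measurable_add measurable_bounded_part borel_measurable_infsum_countable
      countable_cubes measurable_tail)

lemma abs_tail_le:
  assumes "Q \<in> cubes"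
  shows "\<bar>tail Q x\<bar> \<le> 2 * (measure N Q / measure M (dparent d Q) * indicator (dparent d Q) x)"
proof -
  have "\<bar>jump Q\<bar> * measure M Q / measure M (dparent d Q) \<le> 2 * measure N Q / measure M (dparent d Q)"
    using abs_jump_le[OF assms] by (intro divide_right_mono) auto
  then show ?thesis
    by (auto simp: tail_def abs_mult split: split_indicator)
qed

lemma sum_abs_tail_le:
  assumes "F \<subseteq> cubes"
  shows "(\<Sum>Q\<in>F. \<bar>tail Q x\<bar>) \<le> 2 * parent_sum F x"
  unfolding parent_sum_def sum_distrib_left using assms by (intro sum_mono abs_tail_le) auto

text \<open>The first moment of \<open>parent_sum\<close> is bounded uniformly over finite families,
  so by monotone convergence the absolute sum is integrable. Summability has to be known because
  \<open>infsum\<close> defaults to 0, which would invalidate splitting sums and passing to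
  limits.\<close>

lemma AE_tail_summable: "AE x in M. (\<lambda>Q. tail Q x) summable_on cubes"
proof -
  obtain F :: "nat \<Rightarrow> (nat \<Rightarrow> real) set set"
    where F: "incseq F" "\<And>n. finite (F n)" "(\<Union>n. F n) = cubes"
    using countable_exhaustion[OF countable_cubes] by metis
  have Fc: "F n \<subseteq> cubes" for n using F(3) by blast
  have [measurable]: "tail Q \<in> borel_measurable M" if "Q \<in> F n" for Q n
    using that Fc by (intro measurable_tail) auto
  have "(\<integral>\<^sup>+x. (SUP n. ennreal (\<Sum>Q\<in>F n. \<bar>tail Q x\<bar>)) \<partial>M) = (SUP n. \<integral>\<^sup>+x. ennreal (\<Sum>Q\<in>F n. \<bar>tail Q x\<bar>) \<partial>M)"
  proof (rule nn_integral_monotone_convergence_SUP)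
    show "incseq (\<lambda>n x. ennreal (\<Sum>Q\<in>F n. \<bar>tail Q x\<bar>))"
      using F(1,2) by (auto simp: incseq_def le_fun_def intro!: ennreal_leI sum_mono2)
  qed measurable
  also have "\<dots> \<le> ennreal (2 * norm_f)"
  proof (rule SUP_least)
    fix n
    have i: "integrable M (parent_sum (F n))"
      using integrable_parent_sum_power[OF F(2) Fc, of n 0] by simp
    have "(\<integral>\<^sup>+x. ennreal (\<Sum>Q\<in>F n. \<bar>tail Q x\<bar>) \<partial>M) \<le> (\<integral>\<^sup>+x. ennreal (2 * parent_sum (F n) x) \<partial>M)"
      by (intro nn_integral_mono ennreal_leI sum_abs_tail_le Fc)
    also have "\<dots> = ennreal (\<integral>x. 2 * parent_sum (F n) x \<partial>M)"
      by (intro nn_integral_eq_integral integrable_mult_right i) (auto simp: parent_sum_def intro!: sum_nonneg)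
    also have "\<dots> \<le> ennreal (2 * norm_f)"
      using integral_parent_sum_power_le[OF F(2) Fc, of n 0] by (intro ennreal_leI) simp
    finally show "(\<integral>\<^sup>+x. ennreal (\<Sum>Q\<in>F n. \<bar>tail Q x\<bar>) \<partial>M) \<le> ennreal (2 * norm_f)" .
  qed
  also have "\<dots> < \<infinity>" by simp
  finally have "(\<integral>\<^sup>+x. (SUP n. ennreal (\<Sum>Q\<in>F n. \<bar>tail Q x\<bar>)) \<partial>M) \<noteq> \<infinity>"
    by simp
  moreover have "(\<lambda>x. SUP n. ennreal (\<Sum>Q\<in>F n. \<bar>tail Q x\<bar>)) \<in> borel_measurable M"
    by measurable
  ultimately have "AE x in M. (SUP n. ennreal (\<Sum>Q\<in>F n. \<bar>tail Q x\<bar>)) \<noteq> \<infinity>"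
    by (intro nn_integral_PInf_AE)
  then show ?thesis
    unfolding summable_on_iff_exhaustion[OF F] by eventually_elim (simp only: less_top infinity_ennreal_def)
qed

text \<open>The tails cancel between \<open>g\<close> and \<open>\<beta>\<close> where they are
  summable. On a selected cube the remaining terms telescope through the parent average, the average
  over the cube and \<open>f\<close>; off \<open>Om\<close> only \<open>f\<close> is left.\<close>

lemma AE_decomposition:
  "AE x in M. f x = cz_g d M f Om cubes x + (\<Sum>\<^sub>\<infinity>Q\<in>cubes. cz_b d M f Q x) + (\<Sum>\<^sub>\<infinity>Q\<in>cubes. cz_beta d M f Q x)"
  using AE_tail_summable AE_space
proof eventually_elim
  case (elim x)
  let ?W = "\<Sum>\<^sub>\<infinity>Q\<in>cubes. tail Q x"
  have "(\<Sum>\<^sub>\<infinity>Q\<in>cubes. cz_beta d M f Q x) = (\<Sum>\<^sub>\<infinity>Q\<in>cubes. jump Q * indicator Q x - tail Q x)"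
    by (simp add: cz_beta_eq tail_def)
  also have "\<dots> = (\<Sum>\<^sub>\<infinity>Q\<in>cubes. jump Q * indicator Q x) - ?W"
    using infsum_add[OF summable_on_cubes iffD2[OF summable_on_uminus elim(1)], of jump]
    by (simp add: infsum_uminus)
  finally have beta: "(\<Sum>\<^sub>\<infinity>Q\<in>cubes. cz_beta d M f Q x) = (\<Sum>\<^sub>\<infinity>Q\<in>cubes. jump Q * indicator Q x) - ?W" .
  show ?case
  proof (cases "x \<in> Om")
    case True
    then obtain Q where Q: "Q \<in> cubes" "x \<in> Q" using Union_cubes by blast
    show ?thesis
      using True unfolding beta cz_g_eq bounded_part_def cz_b_def infsum_cubes_in[OF Q]
      by (simp add: jump_def)
  next
    case False
    then show ?thesis
      using elim unfolding beta cz_g_eq bounded_part_def cz_b_def infsum_cubes_out[OF False]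
      by simp
  qed
qed

section \<open>Integrability of powers of g\<close>

definition majorant :: "(nat \<Rightarrow> real) \<Rightarrow> real" where
  "majorant x = \<bar>f x\<bar> * indicator (space M - Om) x + lam * indicator Om x"

lemma majorant_nonneg: "0 \<le> majorant x"
  using lam_pos by (simp add: majorant_def)

lemma AE_majorant_le: "AE x in M. majorant x \<le> lam"
  using AE_le_lam by eventually_elim (use lam_pos in \<open>auto simp: majorant_def split: split_indicator\<close>)

lemma abs_bounded_part_le: "x \<in> space M \<Longrightarrow> \<bar>bounded_part x\<bar> \<le> majorant x"
proof (cases "x \<in> Om")
  case True
  then obtain Q where Q: "Q \<in> cubes" "x \<in> Q" using Union_cubes by blast
  then show ?thesis
    using True abs_avg_parent_le[OF Q(1)]
    unfolding bounded_part_def majorant_def infsum_cubes_in[OF Q] by simp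
next
  case False
  then show ?thesis
    unfolding bounded_part_def majorant_def infsum_cubes_out[OF False]
    by (auto split: split_indicator)
qed

text \<open>The weak type (1,1) inequality for the dyadic maximal function, by summing the stopping
  inequality over the disjoint cubes.\<close>

lemma
  shows emeasure_Om: "emeasure M Om \<noteq> \<infinity>" and measure_Om_le: "lam * measure M Om \<le> measure N Om"
proof -
  have "emeasure L (\<Union>cubes) \<le> emeasure N (\<Union>cubes)"
  proof (rule emeasure_UN_disjoint_mono)
  qed (use countable_cubes disjoint_cubes emeasure_L_cube_le in auto)
  then have le: "ennreal lam * emeasure M Om \<le> ennreal (measure N Om)"
    unfolding Union_cubes by (simp add: emeasure_L N.emeasure_eq_measure)
  show fin: "emeasure M Om \<noteq> \<infinity>"
  proof
    assume "emeasure M Om = \<infinity>"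
    then show False using le lam_pos by (simp add: ennreal_mult_top top_unique)
  qed
  have "ennreal (lam * measure M Om) \<le> ennreal (measure N Om)"
    using le lam_pos fin by (simp add: emeasure_eq_ennreal_measure ennreal_mult)
  then show "lam * measure M Om \<le> measure N Om"
    by (simp add: ennreal_le_iff)
qed

text \<open>Replacing |f| by \<open>lam\<close> on \<open>Om\<close> does not raise the integral, by
  the weak type bound.\<close>

lemma integrable_majorant: "integrable M majorant"
  and integral_majorant_le: "(\<integral>x. majorant x \<partial>M) \<le> norm_f"
proof -
  have i: "integrable M (\<lambda>x. \<bar>f x\<bar> * indicator (space M - Om) x)" "integrable M (\<lambda>x. lam * indicator Om x :: real)"
    using integrable_f emeasure_Om
    by (auto intro!: integrable_real_mult_indicator simp: less_top)
  show "integrable M majorant"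
    unfolding majorant_def[abs_def] by (intro Bochner_Integration.integrable_add i)
  have "(\<integral>x. majorant x \<partial>M) = measure N (space M - Om) + lam * measure M Om"
    unfolding majorant_def
    by (subst Bochner_Integration.integral_add[OF i])
       (simp add: measure_N set_lebesgue_integral_def mult.commute Int_absorb2 sets.sets_into_space)
  also have "\<dots> \<le> measure N (space M - Om) + measure N Om"
    using measure_Om_le by simp
  also have "\<dots> = norm_f"
  proof -
    have "(space M - Om) \<inter> Om = {}" "(space M - Om) \<union> Om = space M"
      using sets.sets_into_space[OF Om_sets] by auto
    then show ?thesis
      using N.finite_measure_Union[of "space M - Om" Om] measure_N_space by simp
  qed
  finally show "(\<integral>x. majorant x \<partial>M) \<le> norm_f" .
qed

text \<open>Dividing by \<open>lam\<close> makes the inequality scale free and releases the factor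
  \<open>lam powr (p - 1)\<close>. The real exponent is traded for 1 and the integer
  \<open>Suc m\<close>, for which moments of \<open>S\<close> are available.\<close>

lemma powr_bound:
  assumes h: "0 \<le> h" "h \<le> lam" and S: "0 \<le> S" and y: "\<bar>y\<bar> \<le> h + 2 * S"
    and p: "1 \<le> p" "p \<le> real (Suc m)"
  shows "\<bar>y\<bar> powr p \<le> lam powr (p - 1) * ((1 + 2 ^ Suc m) * h + 2 * S + 4 ^ Suc m / lam ^ m * S ^ Suc m)"
proof -
  let ?k = "Suc m"
  define a where "a = h / lam"
  define b where "b = S / lam"
  have a: "0 \<le> a" "a \<le> 1" and b: "0 \<le> b" using h S lam_pos by (auto simp: a_def b_def)
  have "\<bar>y\<bar> powr p \<le> (lam * (a + 2 * b)) powr p"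
  proof (rule powr_mono2)
    have "lam * (a + 2 * b) = h + 2 * S"
      using lam_pos by (simp add: a_def b_def field_simps)
    with y show "\<bar>y\<bar> \<le> lam * (a + 2 * b)" by simp
  qed (use p in auto)
  also have "\<dots> = lam powr p * (a + 2 * b) powr p"
    using lam_pos a b by (simp add: powr_mult)
  also have "\<dots> \<le> lam powr p * ((a + 2 * b) + (a + 2 * b) ^ ?k)"
    using a b p by (intro mult_left_mono powr_le_add_power) auto
  also have "\<dots> \<le> lam powr p * (a + 2 * b + (2 ^ ?k * a + 4 ^ ?k * b ^ ?k))"
  proof (intro mult_left_mono add_left_mono)
    have "(a + 2 * b) ^ ?k \<le> 2 ^ ?k * (a ^ ?k + (2 * b) ^ ?k)"
      using a b by (intro add_power_le_2) auto
    also have "\<dots> \<le> 2 ^ ?k * (a + (2 * b) ^ ?k)"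
      \<comment> \<open>Since \<open>a\<close> is at most 1, its power is at most \<open>a\<close>,
        so only the first moment of \<open>h\<close> will be needed.\<close>
      using power_decreasing[of 1 ?k a] a by (intro mult_left_mono add_right_mono) auto
    also have "\<dots> = 2 ^ ?k * a + (2 ^ ?k * 2 ^ ?k) * b ^ ?k"
      by (simp only: power_mult_distrib distrib_left mult.assoc)
    also have "2 ^ ?k * 2 ^ ?k = (4 :: real) ^ ?k"
      by (subst power_mult_distrib[symmetric]) simp
    finally show "(a + 2 * b) ^ ?k \<le> 2 ^ ?k * a + 4 ^ ?k * b ^ ?k" .
  qed simp
  finally have "\<bar>y\<bar> powr p \<le> lam powr p * (a + 2 * b + (2 ^ ?k * a + 4 ^ ?k * b ^ ?k))" .
  also have "\<dots> = lam powr (p - 1) * (lam * (a + 2 * b + (2 ^ ?k * a + 4 ^ ?k * b ^ ?k)))"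
    using lam_pos by (simp add: powr_diff)
  also have "lam * (a + 2 * b + (2 ^ ?k * a + 4 ^ ?k * b ^ ?k))
      = (1 + 2 ^ ?k) * h + 2 * S + 4 ^ ?k / lam ^ m * S ^ ?k"
    using lam_pos by (simp add: a_def b_def field_simps)
  finally show ?thesis .
qed

text \<open>Finite truncations \<open>G n\<close> obey a bound independent of \<open>n\<close>, and
  Fatou's lemma passes it to the limit. In the constant, \<open>1 + 2 ^ Suc m\<close> comes from the
  majorant, 2 from the first moment of the parent sum, and \<open>4 ^ Suc m * fact (Suc m)\<close>
  from its moment of order \<open>Suc m\<close>, where \<open>lam ^ m\<close> cancels.\<close>

lemma nn_integral_cz_g_powr_le:
  assumes p: "1 \<le> p" "p \<le> real (Suc m)"
  shows "(\<integral>\<^sup>+x. ennreal (\<bar>cz_g d M f Om cubes x\<bar> powr p) \<partial>M)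
    \<le> ennreal ((3 + 2 ^ Suc m + 4 ^ Suc m * fact (Suc m)) * lam powr (p - 1) * norm_f)"
proof -
  obtain F :: "nat \<Rightarrow> (nat \<Rightarrow> real) set set"
    where F: "incseq F" "\<And>n. finite (F n)" "(\<Union>n. F n) = cubes"
    using countable_exhaustion[OF countable_cubes] by metis
  have Fc: "F n \<subseteq> cubes" for n using F(3) by blast
  have [measurable]: "tail Q \<in> borel_measurable M" if "Q \<in> F n" for Q n
    using that Fc by (intro measurable_tail) auto
  define G where "G n x = bounded_part x + (\<Sum>Q\<in>F n. tail Q x)" for n x
  have [measurable]: "G n \<in> borel_measurable M" for n
    unfolding G_def[abs_def] by measurable
  let ?K = "ennreal ((3 + 2 ^ Suc m + 4 ^ Suc m * fact (Suc m)) * lam powr (p - 1) * norm_f)"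
  have bound: "(\<integral>\<^sup>+x. ennreal (\<bar>G n x\<bar> powr p) \<partial>M) \<le> ?K" for n
  proof -
    let ?S = "parent_sum (F n)"
    let ?B = "\<lambda>x. lam powr (p - 1) * ((1 + 2 ^ Suc m) * majorant x + 2 * ?S x + 4 ^ Suc m / lam ^ m * ?S x ^ Suc m)"
    have S0: "0 \<le> ?S x" for x
      unfolding parent_sum_def by (intro sum_nonneg) auto
    have iS: "integrable M ?S" "integrable M (\<lambda>x. ?S x ^ Suc m)"
      using integrable_parent_sum_power[OF F(2) Fc, of n 0]
        integrable_parent_sum_power[OF F(2) Fc, of n m] by simp_all
    have IS: "(\<integral>x. ?S x \<partial>M) \<le> norm_f" "(\<integral>x. ?S x ^ Suc m \<partial>M) \<le> fact (Suc m) * lam ^ m * norm_f"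
      using integral_parent_sum_power_le[OF F(2) Fc, of n 0]
        integral_parent_sum_power_le[OF F(2) Fc, of n m] by simp_all
    have ptw: "AE x in M. \<bar>G n x\<bar> powr p \<le> ?B x"
      using AE_majorant_le AE_space
    proof eventually_elim
      case (elim x)
      have "\<bar>G n x\<bar> \<le> \<bar>bounded_part x\<bar> + (\<Sum>Q\<in>F n. \<bar>tail Q x\<bar>)"
        unfolding G_def by (rule order_trans[OF abs_triangle_ineq]) (simp add: sum_abs)
      also have "\<dots> \<le> majorant x + 2 * ?S x"
        using elim by (intro add_mono abs_bounded_part_le sum_abs_tail_le Fc)
      finally show ?case
        using elim by (intro powr_bound majorant_nonneg S0 p)
    qed
    have i: "integrable M (\<lambda>x. (1 + 2 ^ Suc m) * majorant x)" "integrable M (\<lambda>x. 2 * ?S x)"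
        "integrable M (\<lambda>x. 4 ^ Suc m / lam ^ m * ?S x ^ Suc m)"
      by (intro integrable_mult_right integrable_majorant iS)+
    have "(\<integral>\<^sup>+x. ennreal (\<bar>G n x\<bar> powr p) \<partial>M) \<le> (\<integral>\<^sup>+x. ennreal (?B x) \<partial>M)"
      using ptw by (intro nn_integral_mono_AE) (auto elim!: eventually_mono intro: ennreal_leI)
    also have "\<dots> = ennreal (\<integral>x. ?B x \<partial>M)"
    proof (rule nn_integral_eq_integral)
      show "integrable M ?B"
        by (intro integrable_mult_right Bochner_Integration.integrable_add i)
      show "AE x in M. 0 \<le> ?B x"
        using lam_pos S0 majorant_nonneg by (auto intro!: AE_I2 mult_nonneg_nonneg add_nonneg_nonneg)
    qed
    also have "(\<integral>x. ?B x \<partial>M) = lam powr (p - 1) * ((1 + 2 ^ Suc m) * (\<integral>x. majorant x \<partial>M)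
        + 2 * (\<integral>x. ?S x \<partial>M) + 4 ^ Suc m / lam ^ m * (\<integral>x. ?S x ^ Suc m \<partial>M))"
      by (simp only: Bochner_Integration.integral_add[OF Bochner_Integration.integrable_add[OF i(1,2)] i(3)]
          Bochner_Integration.integral_add[OF i(1,2)] integral_mult_right_zero)
    also have "\<dots> \<le> lam powr (p - 1) * ((1 + 2 ^ Suc m) * norm_f + 2 * norm_f
        + 4 ^ Suc m / lam ^ m * (fact (Suc m) * lam ^ m * norm_f))"
      using lam_pos by (intro mult_left_mono add_mono integral_majorant_le IS) auto
    also have "\<dots> = (3 + 2 ^ Suc m + 4 ^ Suc m * fact (Suc m)) * lam powr (p - 1) * norm_f"
      using lam_pos by (simp add: field_simps del: fact_Suc)
    finally show ?thesis by (simp add: ennreal_leI)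
  qed
  have lim: "AE x in M. ennreal (\<bar>cz_g d M f Om cubes x\<bar> powr p) = liminf (\<lambda>n. ennreal (\<bar>G n x\<bar> powr p))"
    using AE_tail_summable
  proof eventually_elim
    case (elim x)
    have "(\<lambda>n. G n x) \<longlonglongrightarrow> cz_g d M f Om cubes x"
      unfolding G_def cz_g_eq by (intro tendsto_intros infsum_exhaustion F elim)
    then have "(\<lambda>n. ennreal (\<bar>G n x\<bar> powr p)) \<longlonglongrightarrow> ennreal (\<bar>cz_g d M f Om cubes x\<bar> powr p)"
      using p by (intro tendsto_ennrealI tendsto_powr' tendsto_intros) auto
    then show ?case
      by (rule lim_imp_Liminf[OF sequentially_bot, symmetric])
  qed
  have "(\<integral>\<^sup>+x. ennreal (\<bar>cz_g d M f Om cubes x\<bar> powr p) \<partial>M) = (\<integral>\<^sup>+x. liminf (\<lambda>n. ennreal (\<bar>G n x\<bar> powr p)) \<partial>M)"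
    using lim by (rule nn_integral_cong_AE)
  also have "\<dots> \<le> liminf (\<lambda>n. \<integral>\<^sup>+x. ennreal (\<bar>G n x\<bar> powr p) \<partial>M)"
    by (intro nn_integral_liminf) measurable
  also have "\<dots> \<le> ?K"
    using bound by (intro Liminf_le) auto
  finally show ?thesis .
qed

end

theorem theorem3p4:
  shows "\<exists>C :: real \<Rightarrow> real. \<forall>(d::nat) (M::(nat \<Rightarrow> real) measure) (f::(nat \<Rightarrow> real) \<Rightarrow> real)
      (s::nat \<Rightarrow> bool) (lam::real).
    (1 \<le> d \<and> sets M = sets (PiM {..<d} (\<lambda>_. borel :: real measure))
     \<and> (\<forall>Q. dyadic d Q \<longrightarrow> emeasure M Q < \<infinity>)
     \<and> integrable M f
     \<and> (\<forall>x\<in>space M. x \<notin> quadrant d s \<longrightarrow> f x = 0)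
     \<and> avg M (quadrant d s) (\<lambda>x. \<bar>f x\<bar>) < lam)
    \<longrightarrow> (\<exists>\<Q> :: (nat \<Rightarrow> real) set set.
          let \<Omega> = {x\<in>space M. ereal lam < dmax d M f x};
              g = cz_g d M f \<Omega> \<Q>;
              b = (\<lambda>x. \<Sum>\<^sub>\<infinity>Q\<in>\<Q>. cz_b d M f Q x);
              \<beta> = (\<lambda>x. \<Sum>\<^sub>\<infinity>Q\<in>\<Q>. cz_beta d M f Q x)
          in (\<forall>Q\<in>\<Q>. dyadic d Q \<and> Q \<subseteq> quadrant d s)
           \<and> disjoint \<Q>
           \<and> \<Union>\<Q> = \<Omega>
           \<and> (\<forall>Q\<in>\<Q>. lam < avg M Q (\<lambda>x. \<bar>f x\<bar>) \<and>
                 (\<forall>Q'. dyadic d Q' \<and> Q \<subset> Q' \<longrightarrow> avg M Q' (\<lambda>x. \<bar>f x\<bar>) \<le> lam))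
           \<and> (AE x in M. f x = g x + b x + \<beta> x)
           \<and> g \<in> borel_measurable M
           \<and> (\<forall>p::real. 1 \<le> p \<longrightarrow>
                (\<integral>\<^sup>+ x. ennreal (\<bar>g x\<bar> powr p) \<partial>M)
                  \<le> ennreal (C p * lam powr (p - 1) * (\<integral>x. \<bar>f x\<bar> \<partial>M)))
           \<and> (\<forall>Q\<in>\<Q>. (\<forall>x. x \<notin> Q \<longrightarrow> cz_b d M f Q x = 0)
                 \<and> integrable M (cz_b d M f Q) \<and> (\<integral>x. cz_b d M f Q x \<partial>M) = 0)
           \<and> (\<Sum>\<^sub>\<infinity>Q\<in>\<Q>. \<integral>\<^sup>+ x. ennreal \<bar>cz_b d M f Q x\<bar> \<partial>M)
                \<le> ennreal (2 * (\<integral>x. \<bar>f x\<bar> \<partial>M))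
           \<and> (\<forall>Q\<in>\<Q>. (\<forall>x. x \<notin> dparent d Q \<longrightarrow> cz_beta d M f Q x = 0)
                 \<and> integrable M (cz_beta d M f Q) \<and> (\<integral>x. cz_beta d M f Q x \<partial>M) = 0)
           \<and> (\<Sum>\<^sub>\<infinity>Q\<in>\<Q>. \<integral>\<^sup>+ x. ennreal \<bar>cz_beta d M f Q x\<bar> \<partial>M)
                \<le> ennreal (4 * (\<integral>x. \<bar>f x\<bar> \<partial>M)))"
\<comment> \<open>The integer exponent is the least one not below \<open>p\<close>; it is positive
  for \<open>p \<ge> 1\<close>, hence of the form \<open>Suc m\<close>.\<close>
proof (intro exI[of _ "\<lambda>p. 3 + 2 ^ nat \<lceil>p\<rceil> + 4 ^ nat \<lceil>p\<rceil> * fact (nat \<lceil>p\<rceil>)"] allI impI)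
  fix d :: nat and M :: "(nat \<Rightarrow> real) measure" and f :: "(nat \<Rightarrow> real) \<Rightarrow> real"
    and s :: "nat \<Rightarrow> bool" and lam :: real
  assume asm: "1 \<le> d \<and> sets M = sets (PiM {..<d} (\<lambda>_. borel :: real measure))
     \<and> (\<forall>Q. dyadic d Q \<longrightarrow> emeasure M Q < \<infinity>)
     \<and> integrable M f
     \<and> (\<forall>x\<in>space M. x \<notin> quadrant d s \<longrightarrow> f x = 0)
     \<and> avg M (quadrant d s) (\<lambda>x. \<bar>f x\<bar>) < lam"
  interpret calderon_zygmund d M f s lam
    by standard (use asm in auto)
  have g: "(\<integral>\<^sup>+x. ennreal (\<bar>cz_g d M f Om cubes x\<bar> powr p) \<partial>M)
      \<le> ennreal ((3 + 2 ^ nat \<lceil>p\<rceil> + 4 ^ nat \<lceil>p\<rceil> * fact (nat \<lceil>p\<rceil>)) * lam powr (p - 1) * norm_f)"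
    if "1 \<le> p" for p :: real
  proof -
    have "1 \<le> nat \<lceil>p\<rceil>" using that by linarith
    then obtain m where m: "nat \<lceil>p\<rceil> = Suc m" by (cases "nat \<lceil>p\<rceil>") auto
    moreover have "p \<le> real (nat \<lceil>p\<rceil>)" by linarith
    ultimately show ?thesis
      using nn_integral_cz_g_powr_le[of p m] that by (simp only:)
  qed
  show "\<exists>\<Q>. let \<Omega> = {x\<in>space M. ereal lam < dmax d M f x};
              g = cz_g d M f \<Omega> \<Q>;
              b = (\<lambda>x. \<Sum>\<^sub>\<infinity>Q\<in>\<Q>. cz_b d M f Q x);
              \<beta> = (\<lambda>x. \<Sum>\<^sub>\<infinity>Q\<in>\<Q>. cz_beta d M f Q x)
          in (\<forall>Q\<in>\<Q>. dyadic d Q \<and> Q \<subseteq> quadrant d s)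
           \<and> disjoint \<Q>
           \<and> \<Union>\<Q> = \<Omega>
           \<and> (\<forall>Q\<in>\<Q>. lam < avg M Q (\<lambda>x. \<bar>f x\<bar>) \<and>
                 (\<forall>Q'. dyadic d Q' \<and> Q \<subset> Q' \<longrightarrow> avg M Q' (\<lambda>x. \<bar>f x\<bar>) \<le> lam))
           \<and> (AE x in M. f x = g x + b x + \<beta> x)
           \<and> g \<in> borel_measurable M
           \<and> (\<forall>p::real. 1 \<le> p \<longrightarrow>
                (\<integral>\<^sup>+ x. ennreal (\<bar>g x\<bar> powr p) \<partial>M)
                  \<le> ennreal ((3 + 2 ^ nat \<lceil>p\<rceil> + 4 ^ nat \<lceil>p\<rceil> * fact (nat \<lceil>p\<rceil>)) * lam powr (p - 1) * (\<integral>x. \<bar>f x\<bar> \<partial>M)))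
           \<and> (\<forall>Q\<in>\<Q>. (\<forall>x. x \<notin> Q \<longrightarrow> cz_b d M f Q x = 0)
                 \<and> integrable M (cz_b d M f Q) \<and> (\<integral>x. cz_b d M f Q x \<partial>M) = 0)
           \<and> (\<Sum>\<^sub>\<infinity>Q\<in>\<Q>. \<integral>\<^sup>+ x. ennreal \<bar>cz_b d M f Q x\<bar> \<partial>M)
                \<le> ennreal (2 * (\<integral>x. \<bar>f x\<bar> \<partial>M))
           \<and> (\<forall>Q\<in>\<Q>. (\<forall>x. x \<notin> dparent d Q \<longrightarrow> cz_beta d M f Q x = 0)
                 \<and> integrable M (cz_beta d M f Q) \<and> (\<integral>x. cz_beta d M f Q x \<partial>M) = 0)
           \<and> (\<Sum>\<^sub>\<infinity>Q\<in>\<Q>. \<integral>\<^sup>+ x. ennreal \<bar>cz_beta d M f Q x\<bar> \<partial>M)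
                \<le> ennreal (4 * (\<integral>x. \<bar>f x\<bar> \<partial>M))"
    unfolding Let_def Om_def[symmetric]
  proof (intro exI[of _ cubes] conjI ballI allI impI)
    fix Q assume Q: "Q \<in> cubes"
    show "lam < avg M Q (\<lambda>x. \<bar>f x\<bar>)" using Q by (simp add: cubes_def)
    show "avg M Q' (\<lambda>x. \<bar>f x\<bar>) \<le> lam" if "dyadic d Q' \<and> Q \<subset> Q'" for Q'
      using Q that by (simp add: cubes_def)
    show "cz_b d M f Q x = 0" if "x \<notin> Q" for x
      using that by (simp add: cz_b_def)
    show "cz_beta d M f Q x = 0" if "x \<notin> dparent d Q" for x
      using that cube_subset_parent[OF Q] by (auto simp: cz_beta_def indicator_def)
  qed (simp_all add: cubes_dyadic cubes_subset_quadrant disjoint_cubes Union_cubes AE_decomposition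
      measurable_cz_g g integrable_cz_b integral_cz_b integrable_cz_beta integral_cz_beta
      infsum_cubes_le nn_integral_cz_b_le nn_integral_cz_beta_le del: fact_Suc)
qed

end
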